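(* Let $\alpha\in Y^*$ be such that the eigenvalues of the generalised capacitance matrix $\mathcal{C}^\alpha_G=\mathsf{V}^2\mathsf{L}^{-1}\mathcal{C}^\alpha$ are simple. Let $\omega^\alpha$ be a subwavelength resonance with $\omega^\alpha=\pm\sqrt{\delta\lambda}+O(\delta)$ for an eigenvalue $\lambda$ of $\mathcal C_G^\alpha$, let $\boldsymbol a=(\boldsymbol a^{(1)},\dots,\boldsymbol a^{(N)})^T$ be a corresponding eigenvector, $\mathcal C^\alpha_G\boldsymbol a=\lambda\boldsymbol a$, and let $u^\alpha$ be a (suitably normalised) subwavelength resonant mode associated with $\omega^\alpha$. Then, as $\delta\to0$, $$u^\alpha(x)=\sum_{j=1}^N\boldsymbol a^{(j)}V_j^\alpha(x)+O(\delta).$$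
   Context: Geometry: $N\ge1$; points $0=x_1^{\mathsf L}<x_1^{\mathsf R}<x_2^{\mathsf L}<\dots<x_N^{\mathsf L}<x_N^{\mathsf R}$, a period $L>x_N^{\mathsf R}-x_1^{\mathsf L}$, extended to $i\in\mathbb Z$ by $x_{i+N}^{\mathsf L}=x_i^{\mathsf L}+L$, $x_{i+N}^{\mathsf R}=x_i^{\mathsf R}+L$. Put $D_i=(x_i^{\mathsf L},x_i^{\mathsf R})$, $\ell_i=x_i^{\mathsf R}-x_i^{\mathsf L}$, $s_i=x_{i+1}^{\mathsf L}-x_i^{\mathsf R}$, $\mathfrak C=\bigcup_{i\in\mathbb Z}D_i$, $Y^*=\mathbb R/\frac{2\pi}{L}\mathbb Z$. Material parameters: $v>0$, nonzero $v_1,\dots,v_N$ (all real positive, or complex), and contrast $\delta>0$. The geometry, $v$ and the $v_i$ are fixed while $\delta\to0$. Spectral problem: for $\alpha\in Y^*$, find $\omega\in\mathbb C$ and a nontrivial continuous $u$ with - $u''+\frac{\omega^2}{v^2}u=0$ in $\mathbb R\setminus\overline{\mathfrak C}$, and $u''+\frac{\omega^2}{v_i^2}u=0$ in $D_i+L\mathbb Z$ for $1\le i\le N$; - for all $i\in\mathbb Z$: $u'(x_i^{\mathsf L}+0)=\delta\,u'(x_i^{\mathsf L}-0)$ and $\delta\,u'(x_i^{\mathsf R}+0)=u'(x_i^{\mathsf R}-0)$; - $u(x+L)=e^{\mathrm i\alpha L}u(x)$. A subwavelength resonance is an $\omega^\alpha(\delta)$ for which a nontrivial solution exists and with $\omega^\alpha(\delta)\to0$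 as $\delta\to0$; the associated nontrivial solution $u^\alpha$ is a subwavelength resonant mode. For $1\le j\le N$, $V_j^\alpha$ is the continuous function with $(V_j^\alpha)''=0$ on $\mathbb R\setminus\overline{\mathfrak C}$, $V_j^\alpha=\delta_{ij}$ on $D_i$ ($1\le i\le N$), $V_j^\alpha(x+mL)=e^{\mathrm i\alpha mL}V_j^\alpha(x)$ for $m\in\mathbb Z$. The capacitance matrix is $\mathcal C^\alpha_{ij}=-\int_{\partial D_i}\frac{\partial V_j^\alpha}{\partial\nu}\,d\sigma=(V_j^\alpha)'(x_i^{\mathsf L}-0)-(V_j^\alpha)'(x_i^{\mathsf R}+0)$, and $\mathsf L=\mathrm{diag}(\ell_1,\dots,\ell_N)$, $\mathsf V=\mathrm{diag}(v_1,\dots,v_N)$. *)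

theory Defs
  imports
    "HOL-Analysis.Analysis"
    "HOL-Library.Landau_Symbols"
    "Jordan_Normal_Form.Char_Poly"
begin

unbundle no vec_syntax

text \<open>
  Resonators carry integer indices, and \<open>1, \<dots>, N\<close> is the fundamental cell. The left and
  right endpoints are given directly as functions of the integer index.
\<close>

definition chain :: "nat \<Rightarrow> real \<Rightarrow> (int \<Rightarrow> real) \<Rightarrow> (int \<Rightarrow> real) \<Rightarrow> bool" where
  "chain N L xL xR \<longleftrightarrow>
     N \<ge> 1 \<and> xL 1 = 0 \<and>
     (\<forall>i\<in>{1..int N}. xL i < xR i) \<and>
     (\<forall>i\<in>{1..<int N}. xR i < xL (i + 1)) \<and>
     L > xR (int N) - xL 1 \<and>
     (\<forall>i. xL (i + int N) = xL i + L) \<and>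
     (\<forall>i. xR (i + int N) = xR i + L)"

definition resonator :: "(int \<Rightarrow> real) \<Rightarrow> (int \<Rightarrow> real) \<Rightarrow> int \<Rightarrow> real set" where
  "resonator xL xR i = {xL i <..< xR i}"

definition resonator_length :: "(int \<Rightarrow> real) \<Rightarrow> (int \<Rightarrow> real) \<Rightarrow> int \<Rightarrow> real" where
  "resonator_length xL xR i = xR i - xL i"

definition crystal :: "(int \<Rightarrow> real) \<Rightarrow> (int \<Rightarrow> real) \<Rightarrow> real set" where
  "crystal xL xR = (\<Union>i. resonator xL xR i)"

text \<open>\<open>u'' + k u = 0\<close> on the open set \<open>S\<close>.\<close>

definition helmholtz_on :: "complex \<Rightarrow> (real \<Rightarrow> complex) \<Rightarrow> real set \<Rightarrow> bool" where
  "helmholtz_on k u S \<longleftrightarrow>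
     (\<exists>u'. \<forall>x\<in>S. (u has_vector_derivative u' x) (at x) \<and>
                 (u' has_vector_derivative (- k * u x)) (at x))"

text \<open>\<open>u'(x - 0)\<close> and \<open>u'(x + 0)\<close>.\<close>

definition deriv_left :: "(real \<Rightarrow> complex) \<Rightarrow> real \<Rightarrow> complex" where
  "deriv_left u x = Lim (at_left x) (\<lambda>t. vector_derivative u (at t))"

definition deriv_right :: "(real \<Rightarrow> complex) \<Rightarrow> real \<Rightarrow> complex" where
  "deriv_right u x = Lim (at_right x) (\<lambda>t. vector_derivative u (at t))"

text \<open>
  A quasimomentum in \<open>\<real> / (2\<pi>/L)\<int>\<close> is given by a real representative \<open>\<alpha>\<close>; it only ever
  enters through \<open>exp(\<i> \<alpha> m L)\<close> with \<open>m\<close> an integer.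
\<close>

definition resonant_solution ::
  "nat \<Rightarrow> real \<Rightarrow> (int \<Rightarrow> real) \<Rightarrow> (int \<Rightarrow> real) \<Rightarrow> real \<Rightarrow> (int \<Rightarrow> complex) \<Rightarrow>
   real \<Rightarrow> real \<Rightarrow> complex \<Rightarrow> (real \<Rightarrow> complex) \<Rightarrow> bool" where
  "resonant_solution N L xL xR v vr \<alpha> \<delta> \<omega> u \<longleftrightarrow>
     continuous_on UNIV u \<and> u \<noteq> (\<lambda>x. 0) \<and>
     helmholtz_on (\<omega>\<^sup>2 / (of_real v)\<^sup>2) u (- closure (crystal xL xR)) \<and>
     (\<forall>i\<in>{1..int N}. helmholtz_on (\<omega>\<^sup>2 / (vr i)\<^sup>2) u
        (\<Union>m::int. (\<lambda>x. x + of_int m * L) ` resonator xL xR i)) \<and>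
     (\<forall>i. deriv_right u (xL i) = of_real \<delta> * deriv_left u (xL i)) \<and>
     (\<forall>i. of_real \<delta> * deriv_right u (xR i) = deriv_left u (xR i)) \<and>
     (\<forall>x. u (x + L) = cis (\<alpha> * L) * u x)"

definition subwavelength_resonance ::
  "nat \<Rightarrow> real \<Rightarrow> (int \<Rightarrow> real) \<Rightarrow> (int \<Rightarrow> real) \<Rightarrow> real \<Rightarrow> (int \<Rightarrow> complex) \<Rightarrow>
   real \<Rightarrow> (real \<Rightarrow> complex) \<Rightarrow> bool" where
  "subwavelength_resonance N L xL xR v vr \<alpha> \<omega> \<longleftrightarrow>
     (\<forall>\<^sub>F \<delta> in at_right 0. \<exists>u. resonant_solution N L xL xR v vr \<alpha> \<delta> (\<omega> \<delta>) u) \<and>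
     (\<omega> \<longlongrightarrow> 0) (at_right 0)"

definition resonant_mode ::
  "nat \<Rightarrow> real \<Rightarrow> (int \<Rightarrow> real) \<Rightarrow> (int \<Rightarrow> real) \<Rightarrow> real \<Rightarrow> (int \<Rightarrow> complex) \<Rightarrow>
   real \<Rightarrow> (real \<Rightarrow> complex) \<Rightarrow> (real \<Rightarrow> real \<Rightarrow> complex) \<Rightarrow> bool" where
  "resonant_mode N L xL xR v vr \<alpha> \<omega> u \<longleftrightarrow>
     (\<forall>\<^sub>F \<delta> in at_right 0. resonant_solution N L xL xR v vr \<alpha> \<delta> (\<omega> \<delta>) (u \<delta>))"

definition is_cap_potential ::
  "nat \<Rightarrow> real \<Rightarrow> (int \<Rightarrow> real) \<Rightarrow> (int \<Rightarrow> real) \<Rightarrow> real \<Rightarrow> int \<Rightarrow> (real \<Rightarrow> complex) \<Rightarrow> bool" where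
  "is_cap_potential N L xL xR \<alpha> j V \<longleftrightarrow>
     continuous_on UNIV V \<and>
     helmholtz_on 0 V (- closure (crystal xL xR)) \<and>
     (\<forall>i\<in>{1..int N}. \<forall>x\<in>resonator xL xR i. V x = (if i = j then 1 else 0)) \<and>
     (\<forall>x. \<forall>m::int. V (x + of_int m * L) = cis (\<alpha> * of_int m * L) * V x)"

definition cap_potential ::
  "nat \<Rightarrow> real \<Rightarrow> (int \<Rightarrow> real) \<Rightarrow> (int \<Rightarrow> real) \<Rightarrow> real \<Rightarrow> int \<Rightarrow> real \<Rightarrow> complex" where
  "cap_potential N L xL xR \<alpha> j = (THE V. is_cap_potential N L xL xR \<alpha> j V)"

text \<open>Matrix and vector indices start at \<open>0\<close>: position \<open>i\<close> belongs to resonator \<open>i + 1\<close>.\<close>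

definition cap_matrix ::
  "nat \<Rightarrow> real \<Rightarrow> (int \<Rightarrow> real) \<Rightarrow> (int \<Rightarrow> real) \<Rightarrow> real \<Rightarrow> complex mat" where
  "cap_matrix N L xL xR \<alpha> = Matrix.mat N N (\<lambda>(i, j).
     deriv_left (cap_potential N L xL xR \<alpha> (int j + 1)) (xL (int i + 1)) -
     deriv_right (cap_potential N L xL xR \<alpha> (int j + 1)) (xR (int i + 1)))"

definition gen_cap_matrix ::
  "nat \<Rightarrow> real \<Rightarrow> (int \<Rightarrow> real) \<Rightarrow> (int \<Rightarrow> real) \<Rightarrow> (int \<Rightarrow> complex) \<Rightarrow> real \<Rightarrow> complex mat" where
  "gen_cap_matrix N L xL xR vr \<alpha> =
     mat_diag N (\<lambda>i. (vr (int i + 1))\<^sup>2) *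
     mat_diag N (\<lambda>i. inverse (of_real (resonator_length xL xR (int i + 1)))) *
     cap_matrix N L xL xR \<alpha>"

text \<open>Simplicity is algebraic: for complex wave speeds the matrix need not be diagonalisable.\<close>

definition simple_eigenvalues :: "complex mat \<Rightarrow> bool" where
  "simple_eigenvalues A \<longleftrightarrow> (\<forall>k. eigenvalue A k \<longrightarrow> Polynomial.order k (char_poly A) = 1)"

end

theory Submission
  imports Defs
begin

text \<open>
  Let \<open>b i\<close> be the value of a resonant solution \<open>u\<close> with maximum modulus \<open>M\<close> at the left end of
  resonator \<open>i\<close>. Since \<open>\<omega>\<^sup>2 = O(\<delta>)\<close>, the solution is affine up to \<open>O(\<delta> M)\<close> in every gap, and the
  jump conditions make its slope in the resonators \<open>O(\<delta> M)\<close>. Hence \<open>u\<close> is within \<open>O(\<delta> M)\<close> of the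
  function that equals \<open>b i\<close> on resonator \<open>i\<close> and is affine in the gaps, that is, of \<open>\<Sum>j b j V\<^sub>j\<close>.
  Integrating \<open>u''\<close> over resonator \<open>i\<close> and using the jump conditions again, \<open>b\<close> is an approximate
  eigenvector: \<open>C\<^sub>G b = (\<omega>\<^sup>2 / \<delta>) b + O(\<delta> M)\<close>, where \<open>\<omega>\<^sup>2 / \<delta>\<close> tends to \<open>\<lambda>\<close>. As \<open>\<lambda>\<close> is algebraically
  simple, the part of \<open>b\<close> transversal to the eigenvector is controlled by the residual alone, without
  any loss from the rate of convergence of \<open>\<omega>\<^sup>2 / \<delta>\<close>; so \<open>b\<close> is \<open>O(\<delta> M)\<close>-close to a multiple of \<open>a\<close>.
\<close>

section \<open>The Helmholtz equation on an interval\<close>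

lemma helmholtz_on_subset: "helmholtz_on k u T \<Longrightarrow> S \<subseteq> T \<Longrightarrow> helmholtz_on k u S"
  unfolding helmholtz_on_def by (meson subsetD)

lemma vector_derivative_bound_interval:
  fixes f :: "real \<Rightarrow> 'a::real_normed_vector"
  assumes "continuous_on {p..q} f" "p \<le> q"
    and "\<And>x. p < x \<Longrightarrow> x < q \<Longrightarrow> (f has_vector_derivative f' x) (at x)"
    and "\<And>x. p < x \<Longrightarrow> x < q \<Longrightarrow> norm (f' x) \<le> B"
  shows "norm (f q - f p) \<le> B * (q - p)"
proof (cases "p = q")
  case False
  then have "p < q" using assms by simp
  have "norm (f q - f p) \<le> B * q - B * p"
    by (rule differentiable_bound_general[where \<phi> = "\<lambda>x. B * x" and \<phi>' = "\<lambda>_. B"])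
       (use assms \<open>p < q\<close> in \<open>auto intro!: continuous_intros derivative_eq_intros\<close>)
  then show ?thesis by (simp add: algebra_simps)
qed simp

text \<open>\<open>helmholtz_on\<close> says nothing at the endpoints. Since \<open>- k * u\<close>
  is continuous on the closed interval, its integral extends the derivative continuously to both
  ends; hence the limits in \<open>deriv_right u p\<close> and \<open>deriv_left u q\<close> exist
  and are values of \<open>w\<close>.\<close>

lemma helmholtz_interval:
  assumes "p < q" "helmholtz_on k u {p<..<q}" "continuous_on {p..q} u"
  obtains w where "continuous_on {p..q} w"
    and "\<And>x. p < x \<Longrightarrow> x < q \<Longrightarrow> (u has_vector_derivative w x) (at x)"
    and "\<And>x. p < x \<Longrightarrow> x < q \<Longrightarrow> (w has_vector_derivative - k * u x) (at x)"
    and "deriv_right u p = w p" "deriv_left u q = w q"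
proof -
  obtain u' where "\<forall>x\<in>{p<..<q}. (u has_vector_derivative u' x) (at x) \<and>
      (u' has_vector_derivative - k * u x) (at x)"
    using assms(2) unfolding helmholtz_on_def by blast
  then have u': "\<And>x. p < x \<Longrightarrow> x < q \<Longrightarrow> (u has_vector_derivative u' x) (at x)"
      "\<And>x. p < x \<Longrightarrow> x < q \<Longrightarrow> (u' has_vector_derivative - k * u x) (at x)"
    by auto
  define U where "U x = integral {p..x} (\<lambda>x. - k * u x)" for x
  have cU: "continuous_on {p..q} (\<lambda>x. - k * u x)" by (intro continuous_intros assms)
  have dU: "(U has_vector_derivative - k * u x) (at x within {p..q})" if "x \<in> {p..q}" for x
    unfolding U_def by (rule integral_has_vector_derivative[OF cU that])
  have dU': "(U has_vector_derivative - k * u x) (at x)" if "p < x" "x < q" for x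
    using dU[of x] that by (simp add: at_within_Icc_at)
  have contU: "continuous_on {p..q} U"
    using dU by (meson continuous_on_vector_derivative)
  \<comment> \<open>An interior sample point, which fixes the constant between \<open>u'\<close> and
    \<open>U\<close>.\<close>
  define c where "c = (p + q) / 2"
  have c: "p < c" "c < q" using assms(1) by (auto simp: c_def)
  have "((\<lambda>x. u' x - U x) has_vector_derivative 0) (at x within {p<..<q})"
    if "x \<in> {p<..<q}" for x
    using has_vector_derivative_diff[OF u'(2) dU'] that
    by (auto intro: has_vector_derivative_at_within)
  then obtain d where "\<And>x. x \<in> {p<..<q} \<Longrightarrow> u' x - U x = d"
    using has_vector_derivative_zero_constant[of "{p<..<q}" "\<lambda>x. u' x - U x"] by auto
  then have const: "u' x - U x = u' c - U c" if "p < x" "x < q" for x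
    using c that by auto
  define w where "w x = U x + (u' c - U c)" for x
  have cw: "continuous_on {p..q} w" unfolding w_def by (intro continuous_intros contU)
  have wu: "w x = u' x" if "p < x" "x < q" for x using const[OF that] by (simp add: w_def algebra_simps)
  have duw: "(u has_vector_derivative w x) (at x)" if "p < x" "x < q" for x
    using u'(1) wu that by simp
  have dw: "(w has_vector_derivative - k * u x) (at x)" if "p < x" "x < q" for x
    unfolding w_def using dU'[OF that] by (simp add: has_vector_derivative_add_const)
  have vd: "vector_derivative u (at t) = w t" if "p < t" "t < q" for t
    using duw[OF that] by (rule vector_derivative_at)
  have "(w \<longlongrightarrow> w p) (at_right p)" "(w \<longlongrightarrow> w q) (at_left q)"
    using continuous_on_Icc_at_rightD[OF cw assms(1)] continuous_on_Icc_at_leftD[OF cw assms(1)] .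
  moreover have "\<forall>\<^sub>F t in at_right p. w t = vector_derivative u (at t)"
    using eventually_at_right_real[OF assms(1)] by eventually_elim (use vd in auto)
  moreover have "\<forall>\<^sub>F t in at_left q. w t = vector_derivative u (at t)"
    using eventually_at_left_real[OF assms(1)] by eventually_elim (use vd in auto)
  ultimately have *: "((\<lambda>t. vector_derivative u (at t)) \<longlongrightarrow> w p) (at_right p)"
      "((\<lambda>t. vector_derivative u (at t)) \<longlongrightarrow> w q) (at_left q)"
    by (auto intro: Lim_transform_eventually)
  have lims: "deriv_right u p = w p" "deriv_left u q = w q"
    unfolding deriv_right_def deriv_left_def by (rule tendsto_Lim[OF _ *(1)] tendsto_Lim[OF _ *(2)]; simp)+
  show thesis by (rule that[OF cw duw dw lims])
qed

lemma helmholtz_increment_bounds: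
  assumes "p < q" and w: "continuous_on {p..q} w"
    and dw: "\<And>x. p < x \<Longrightarrow> x < q \<Longrightarrow> (w has_vector_derivative - k * u x) (at x)"
    and bound: "\<And>x. p \<le> x \<Longrightarrow> x \<le> q \<Longrightarrow> cmod (u x) \<le> M"
    and "p \<le> x" "x \<le> q" "p \<le> y" "y \<le> q"
  shows "cmod (w x - w y) \<le> cmod k * M * (q - p)"
proof -
  have M: "0 \<le> M" using bound[of p] \<open>p < q\<close> norm_ge_zero[of "u p"] by linarith
  have *: "cmod (w y - w x) \<le> cmod k * M * (q - p)" if "p \<le> x" "x \<le> y" "y \<le> q" for x y
  proof -
    have "cmod (w y - w x) \<le> cmod k * M * (y - x)"
    proof (rule vector_derivative_bound_interval[where f' = "\<lambda>x. - k * u x"])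
      show "(w has_vector_derivative - k * u t) (at t)" if "x < t" "t < y" for t
        using dw[of t] that \<open>p \<le> x\<close> \<open>y \<le> q\<close> by simp
    qed (use that in \<open>auto intro!: continuous_on_subset[OF w] bound mult_left_mono simp: norm_mult\<close>)
    also have "\<dots> \<le> cmod k * M * (q - p)" using that M by (intro mult_left_mono) auto
    finally show ?thesis .
  qed
  show ?thesis
    using *[of x y] *[of y x] assms by (cases "x \<le> y") (auto simp: norm_minus_commute)
qed

text \<open>The second derivative is bounded by \<open>cmod k * M\<close>, so the first derivative
  is nearly constant; the chord slope \<open>\<tau>\<close> is its mean and hence close to each of
  its values.\<close>

lemma helmholtz_gap_estimate:
  assumes pq: "p < q" and hh: "helmholtz_on k u {p<..<q}" and u: "continuous_on {p..q} u"
    and bound: "\<And>x. p \<le> x \<Longrightarrow> x \<le> q \<Longrightarrow> cmod (u x) \<le> M"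
  defines "\<tau> \<equiv> (u q - u p) / of_real (q - p)"
  shows "cmod (deriv_right u p - \<tau>) \<le> cmod k * M * (q - p)"
    and "cmod (deriv_left u q - \<tau>) \<le> cmod k * M * (q - p)"
    and "\<And>x. p \<le> x \<Longrightarrow> x \<le> q \<Longrightarrow> cmod (u x - u p - of_real (x - p) * \<tau>) \<le> cmod k * M * (q - p)\<^sup>2"
proof -
  obtain w where w: "continuous_on {p..q} w"
      "\<And>x. p < x \<Longrightarrow> x < q \<Longrightarrow> (u has_vector_derivative w x) (at x)"
      "\<And>x. p < x \<Longrightarrow> x < q \<Longrightarrow> (w has_vector_derivative - k * u x) (at x)"
      "deriv_right u p = w p" "deriv_left u q = w q"
    by (rule helmholtz_interval[OF pq hh u]) (rule that; assumption)
  note inc = helmholtz_increment_bounds[OF pq w(1) w(3) bound]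
  have M: "0 \<le> M" using bound[of p] \<open>p < q\<close> norm_ge_zero[of "u p"] by linarith
  have *: "cmod (w x - \<tau>) \<le> cmod k * M * (q - p)" if "p \<le> x" "x \<le> q" for x
  proof -
    \<comment> \<open>Subtracting a line of slope \<open>w x\<close> leaves a function with
      derivative \<open>w t - w x\<close>; its total increment compares \<open>\<tau>\<close> with
      \<open>w x\<close>.\<close>
    have "cmod ((\<lambda>t. u t - of_real t * w x) q - (\<lambda>t. u t - of_real t * w x) p)
        \<le> cmod k * M * (q - p) * (q - p)"
      by (rule vector_derivative_bound_interval[where f' = "\<lambda>t. w t - w x"])
         (use pq that in \<open>auto intro!: continuous_intros u w derivative_eq_intros inc\<close>)
    moreover have "(\<lambda>t. u t - of_real t * w x) q - (\<lambda>t. u t - of_real t * w x) p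
        = of_real (q - p) * (\<tau> - w x)"
      using pq by (simp add: \<tau>_def field_simps)
    ultimately have "(q - p) * cmod (\<tau> - w x) \<le> (q - p) * (cmod k * M * (q - p))"
      using pq by (simp add: norm_mult mult_ac flip: of_real_diff)
    then have "cmod (\<tau> - w x) \<le> cmod k * M * (q - p)"
      by (rule mult_left_le_imp_le) (use pq in simp)
    then show ?thesis by (simp add: norm_minus_commute)
  qed
  show "cmod (deriv_right u p - \<tau>) \<le> cmod k * M * (q - p)"
    "cmod (deriv_left u q - \<tau>) \<le> cmod k * M * (q - p)"
    using * w pq by auto
  fix x assume x: "p \<le> x" "x \<le> q"
  have "cmod ((\<lambda>t. u t - of_real t * \<tau>) x - (\<lambda>t. u t - of_real t * \<tau>) p)
      \<le> cmod k * M * (q - p) * (x - p)"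
    by (rule vector_derivative_bound_interval[where f' = "\<lambda>t. w t - \<tau>"])
       (use pq x in \<open>auto intro!: continuous_intros continuous_on_subset[OF u] w derivative_eq_intros *\<close>)
  also have "\<dots> \<le> cmod k * M * (q - p) * (q - p)" using x pq M by (intro mult_left_mono) auto
  finally show "cmod (u x - u p - of_real (x - p) * \<tau>) \<le> cmod k * M * (q - p)\<^sup>2"
    by (simp add: power2_eq_square algebra_simps)
qed

text \<open>Inside a resonator the slope is controlled by its initial value \<open>D\<close>, which
  the jump condition will make small. The second bound is the flux balance obtained by integrating
  \<open>- k * u\<close> with \<open>u\<close> frozen at \<open>u p\<close>; its error is a multiple
  of \<open>cmod k * E\<close>, where both factors are small in the application.\<close>

lemma helmholtz_resonator_estimate:
  assumes pq: "p < q" and hh: "helmholtz_on k u {p<..<q}" and u: "continuous_on {p..q} u"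
    and bound: "\<And>x. p \<le> x \<Longrightarrow> x \<le> q \<Longrightarrow> cmod (u x) \<le> M"
  defines "D \<equiv> deriv_right u p"
  defines "E \<equiv> (cmod D + cmod k * M * (q - p)) * (q - p)"
  shows "\<And>x. p \<le> x \<Longrightarrow> x \<le> q \<Longrightarrow> cmod (u x - u p) \<le> E"
    and "cmod (deriv_left u q - D + k * of_real (q - p) * u p) \<le> cmod k * E * (q - p)"
proof -
  obtain w where w: "continuous_on {p..q} w"
      "\<And>x. p < x \<Longrightarrow> x < q \<Longrightarrow> (u has_vector_derivative w x) (at x)"
      "\<And>x. p < x \<Longrightarrow> x < q \<Longrightarrow> (w has_vector_derivative - k * u x) (at x)"
      "deriv_right u p = w p" "deriv_left u q = w q"
    by (rule helmholtz_interval[OF pq hh u]) (rule that; assumption)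
  note inc = helmholtz_increment_bounds[OF pq w(1) w(3) bound]
  have M: "0 \<le> M" using bound[of p] \<open>p < q\<close> norm_ge_zero[of "u p"] by linarith
  have wD: "cmod (w x) \<le> cmod D + cmod k * M * (q - p)" if "p \<le> x" "x \<le> q" for x
    using inc[of x p] norm_triangle_sub[of "w x" "w p"] that pq by (auto simp: D_def w)
  show *: "cmod (u x - u p) \<le> E" if x: "p \<le> x" "x \<le> q" for x
  proof -
    have "cmod (u x - u p) \<le> (cmod D + cmod k * M * (q - p)) * (x - p)"
      by (rule vector_derivative_bound_interval[where f' = w])
         (use pq x in \<open>auto intro!: continuous_intros continuous_on_subset[OF u] w wD\<close>)
    also have "\<dots> \<le> E" unfolding E_def using x pq M by (intro mult_left_mono) auto
    finally show ?thesis .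
  qed
  \<comment> \<open>The added linear term turns the derivative of \<open>w\<close> into
    \<open>- k * (u x - u p)\<close>, to which the first bound applies.\<close>
  have "cmod ((\<lambda>t. w t + k * of_real t * u p) q - (\<lambda>t. w t + k * of_real t * u p) p)
      \<le> cmod k * E * (q - p)"
  proof (rule vector_derivative_bound_interval[where f' = "\<lambda>t. - k * u t + k * u p"])
    fix x assume x: "p < x" "x < q"
    have "cmod (- k * u x + k * u p) = cmod k * cmod (u x - u p)"
      by (simp add: norm_minus_commute algebra_simps flip: norm_mult)
    then show "cmod (- k * u x + k * u p) \<le> cmod k * E"
      using *[of x] x by (simp add: mult_left_mono)
  qed (use pq in \<open>auto intro!: continuous_intros w derivative_eq_intros\<close>)
  then show "cmod (deriv_left u q - D + k * of_real (q - p) * u p) \<le> cmod k * E * (q - p)"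
    by (simp add: w D_def algebra_simps)
qed

text \<open>For \<open>k = 0\<close> every error term of the gap estimate vanishes; compactness
  supplies some bound \<open>M\<close>.\<close>

lemma harmonic_interval:
  assumes pq: "p < q" and hh: "helmholtz_on 0 u {p<..<q}" and u: "continuous_on {p..q} u"
  defines "\<tau> \<equiv> (u q - u p) / of_real (q - p)"
  shows "deriv_right u p = \<tau>" and "deriv_left u q = \<tau>"
    and "\<And>x. p \<le> x \<Longrightarrow> x \<le> q \<Longrightarrow> u x = u p + of_real (x - p) * \<tau>"
proof -
  have "bounded (u ` {p..q})" by (intro compact_imp_bounded compact_continuous_image u) simp
  then obtain M where "\<And>x. p \<le> x \<Longrightarrow> x \<le> q \<Longrightarrow> cmod (u x) \<le> M"
    unfolding bounded_iff by (meson atLeastAtMost_iff imageI)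
  note est = helmholtz_gap_estimate[OF pq hh u this, folded \<tau>_def]
  show "deriv_right u p = \<tau>" "deriv_left u q = \<tau>"
    "\<And>x. p \<le> x \<Longrightarrow> x \<le> q \<Longrightarrow> u x = u p + of_real (x - p) * \<tau>"
    using est by (auto simp: algebra_simps)
qed

section \<open>Perturbation of a simple eigenvalue\<close>

text \<open>
  With \<open>M(x)\<close> the adjugate of \<open>x I - A\<close>, write \<open>M(x) = m + (x - \<lambda>) R(x)\<close> and
  \<open>det (x I - A) = (x - \<lambda>) q(x)\<close>. Since \<open>m (\<lambda> I - A) = 0\<close>, both sides of
  \<open>M(x) (x I - A) b = det (x I - A) b\<close> are divisible by \<open>x - \<lambda>\<close>; the quotient is the second claim.
  Up to the factor \<open>q(\<lambda>)\<close>, \<open>m\<close> is the spectral projection onto the eigenspace.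
\<close>

lemma simple_eigenvalue_adjugate:
  fixes A :: "complex mat"
  assumes A: "A \<in> carrier_mat n n" and ord: "Polynomial.order lam (char_poly A) = 1"
  obtains m :: "nat \<Rightarrow> nat \<Rightarrow> complex" and R :: "nat \<Rightarrow> nat \<Rightarrow> complex poly" and q :: "complex poly"
  where "poly q lam \<noteq> 0"
    and "\<And>i b \<mu>. i < n \<Longrightarrow> (\<Sum>k<n. m i k * b k) +
           (\<Sum>k<n. poly (R i k) \<mu> * (\<mu> * b k - (\<Sum>j<n. A $$ (k, j) * b j))) = poly q \<mu> * b i"
    and "\<And>i k. i < n \<Longrightarrow> k < n \<Longrightarrow> (\<Sum>j<n. A $$ (i, j) * m j k) = lam * m i k"
    and "\<And>i k. i < n \<Longrightarrow> k < n \<Longrightarrow>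
           m i k = (- 1) ^ (k + i) * Determinant.det (mat_delete (lam \<cdot>\<^sub>m 1\<^sub>m n - A) k i)"
proof -
  define B where "B = char_poly_matrix A"
  define p where "p = char_poly A"
  have B: "B \<in> carrier_mat n n" using A by (simp add: B_def)
  have detB: "Determinant.det B = p" by (simp add: B_def p_def char_poly_def)
  define M where "M i k = adj_mat B $$ (i, k)" for i k
  have M_carrier: "adj_mat B \<in> carrier_mat n n" by (rule adj_mat(1)[OF B])
  have Bx: "poly (B $$ (k, j)) x = (if k = j then x else 0) - A $$ (k, j)" if "k < n" "j < n" for k j x
    using A that by (simp add: B_def char_poly_matrix_def)
  have MB: "(\<Sum>k<n. M i k * B $$ (k, j)) = (if i = j then p else 0)" if "i < n" "j < n" for i j
  proof -
    have "(adj_mat B * B) $$ (i, j) = (\<Sum>k<n. M i k * B $$ (k, j))"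
      using that B M_carrier by (simp add: scalar_prod_def M_def atLeast0LessThan)
    then show ?thesis using that adj_mat(3)[OF B] detB by (cases "i = j") simp_all
  qed
  have BM: "(\<Sum>k<n. B $$ (i, k) * M k j) = (if i = j then p else 0)" if "i < n" "j < n" for i j
  proof -
    have "(B * adj_mat B) $$ (i, j) = (\<Sum>k<n. B $$ (i, k) * M k j)"
      using that B M_carrier by (simp add: scalar_prod_def M_def atLeast0LessThan)
    then show ?thesis using that adj_mat(2)[OF B] detB by (cases "i = j") simp_all
  qed
  have "p \<noteq> 0" using degree_monic_char_poly[OF A] by (auto simp: p_def)
  \<comment> \<open>Order one means that exactly one factor \<open>x - lam\<close> splits off, so
    \<open>q\<close> does not vanish at \<open>lam\<close>.\<close>
  obtain q where pq: "p = [:- lam, 1:] * q" and q: "\<not> [:- lam, 1:] dvd q"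
    using order_decomp[OF \<open>p \<noteq> 0\<close>, of lam] ord by (auto simp: p_def)
  define m where "m i k = poly (M i k) lam" for i k
  define R where "R i k = synthetic_div (M i k) lam" for i k
  have MR: "poly (M i k) x = m i k + (x - lam) * poly (R i k) x" for i k x
  proof -
    have "poly (M i k) x = poly ([:- lam, 1:] * R i k + [:m i k:]) x"
      unfolding R_def m_def synthetic_div_correct' ..
    then show ?thesis by (simp add: algebra_simps)
  qed
  have Mr: "(\<Sum>k<n. poly (M i k) x * (x * b k - (\<Sum>j<n. A $$ (k, j) * b j))) = poly p x * b i"
    if "i < n" for i x b
  proof -
    have *: "x * b k - (\<Sum>j<n. A $$ (k, j) * b j) = (\<Sum>j<n. poly (B $$ (k, j)) x * b j)"
      if "k < n" for k
      using that by (simp add: Bx left_diff_distrib sum_subtractf if_distrib[of "\<lambda>t. t * _"] cong: if_cong)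
    have "(\<Sum>k<n. poly (M i k) x * (x * b k - (\<Sum>j<n. A $$ (k, j) * b j)))
        = (\<Sum>k<n. \<Sum>j<n. poly (M i k) x * poly (B $$ (k, j)) x * b j)"
      by (simp add: * sum_distrib_left mult.assoc)
    also have "\<dots> = (\<Sum>j<n. poly (\<Sum>k<n. M i k * B $$ (k, j)) x * b j)"
      by (subst sum.swap) (simp add: poly_sum sum_distrib_right)
    also have "\<dots> = (\<Sum>j<n. (if i = j then poly p x * b j else 0))"
      using that by (intro sum.cong) (auto simp: MB)
    also have "\<dots> = poly p x * b i" using that by simp
    finally show ?thesis .
  qed
  show thesis
  proof
    show "poly q lam \<noteq> 0" using q by (simp add: poly_eq_0_iff_dvd)
    show "(\<Sum>k<n. m i k * b k) +
        (\<Sum>k<n. poly (R i k) \<mu> * (\<mu> * b k - (\<Sum>j<n. A $$ (k, j) * b j))) = poly q \<mu> * b i"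
      if i: "i < n" for i b \<mu>
    proof -
      define S where "S k = (\<Sum>j<n. A $$ (k, j) * b j)" for k
      \<comment> \<open>The quotient identity is treated as an identity of polynomials: there the
        factor \<open>x - lam\<close> can be cancelled, which covers \<open>\<mu> = lam\<close> as
        well.\<close>
      define P where "P = [:\<Sum>k<n. m i k * b k:] + (\<Sum>k<n. R i k * [:- S k, b k:]) - Polynomial.smult (b i) q"
      have P: "poly P x = (\<Sum>k<n. m i k * b k) + (\<Sum>k<n. poly (R i k) x * (x * b k - S k))
          - poly q x * b i" for x
        by (simp add: P_def poly_sum algebra_simps)
      have "(x - lam) * poly P x = 0" for x
      proof -
        have px: "poly p x = (x - lam) * poly q x" by (simp add: pq algebra_simps)
        \<comment> \<open>At \<open>lam\<close> the right side of \<open>Mr\<close> vanishes, so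
          \<open>x - lam\<close> times the constant term of \<open>P\<close> becomes the
          \<open>m\<close> part of the sum taken at \<open>x\<close>.\<close>
        have m0: "(\<Sum>k<n. m i k * (lam * b k - S k)) = 0"
          using Mr[OF i, of lam b] by (simp add: pq m_def S_def)
        have "(x - lam) * (\<Sum>k<n. m i k * b k)
            = (\<Sum>k<n. m i k * (x * b k - S k)) - (\<Sum>k<n. m i k * (lam * b k - S k))"
          unfolding sum_subtractf[symmetric] sum_distrib_left
          by (intro sum.cong refl) (simp add: algebra_simps)
        then have "(x - lam) * poly P x = (\<Sum>k<n. m i k * (x * b k - S k))
            + (\<Sum>k<n. (x - lam) * (poly (R i k) x * (x * b k - S k))) - (x - lam) * poly q x * b i"
          unfolding P m0 by (simp add: algebra_simps sum_distrib_left)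
        also have "\<dots> = (\<Sum>k<n. poly (M i k) x * (x * b k - S k)) - poly p x * b i"
          by (simp only: MR px distrib_right sum.distrib mult.assoc)
        also have "\<dots> = 0" using Mr[OF i, of x b] by (simp add: S_def)
        finally show ?thesis .
      qed
      then have "\<forall>x. poly ([:- lam, 1:] * P) x = 0" by (simp add: algebra_simps)
      then have "[:- lam, 1:] * P = 0" by (simp only: poly_all_0_iff_0)
      then have "poly P \<mu> = 0" by (metis mult_eq_0_iff pCons_eq_0_iff poly_0 zero_neq_one)
      then show ?thesis unfolding P by (simp add: S_def)
    qed
    show "(\<Sum>j<n. A $$ (i, j) * m j k) = lam * m i k" if "i < n" "k < n" for i k
    proof -
      \<comment> \<open>\<open>B\<close> times its adjugate is \<open>p\<close> times the identity;
        evaluation at the root \<open>lam\<close> shows that the columns of \<open>m\<close> lie in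
        the eigenspace.\<close>
      have "0 = poly (\<Sum>j<n. B $$ (i, j) * M j k) lam" by (simp add: BM that pq)
      also have "\<dots> = (\<Sum>j<n. (if i = j then lam * m j k else 0) - A $$ (i, j) * m j k)"
        unfolding poly_sum using that by (intro sum.cong) (auto simp: Bx m_def algebra_simps)
      also have "\<dots> = lam * m i k - (\<Sum>j<n. A $$ (i, j) * m j k)"
        using that by (simp add: sum_subtractf)
      finally show ?thesis by simp
    qed
    show "m i k = (- 1) ^ (k + i) * Determinant.det (mat_delete (lam \<cdot>\<^sub>m 1\<^sub>m n - A) k i)"
      if "i < n" "k < n" for i k
    proof -
      \<comment> \<open>Evaluation at \<open>lam\<close> commutes with the determinant, so the
        minors of the polynomial matrix become minors of a constant one.\<close>
      have "poly (Determinant.det (mat_delete B k i)) lam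
          = Determinant.det (mat_delete (lam \<cdot>\<^sub>m 1\<^sub>m n - A) k i)"
      proof (rule poly_det_cong)
        show "poly (mat_delete B k i $$ (i', j')) lam = mat_delete (lam \<cdot>\<^sub>m 1\<^sub>m n - A) k i $$ (i', j')"
          if "i' < n - 1" "j' < n - 1" for i' j'
        proof -
          have "insert_index k i' < n" "insert_index i j' < n"
            using that by (auto simp: insert_index_def)
          then show ?thesis using A B that by (simp add: mat_delete_def insert_index_def Bx)
        qed
      qed (use A B in \<open>auto intro!: mat_delete_carrier\<close>)
      then show ?thesis
        using that B by (simp add: m_def M_def adj_mat_def cofactor_def poly_power)
    qed
  qed
qed

text \<open>The adjugate maps every vector into the eigenspace; this identifies the image as a
  multiple of the given eigenvector.\<close>

lemma simple_eigenvalue_kernel: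
  fixes A :: "complex mat"
  assumes A: "A \<in> carrier_mat n n" and ord: "Polynomial.order lam (char_poly A) = 1"
    and a: "\<And>i. i < n \<Longrightarrow> (\<Sum>j<n. A $$ (i, j) * a j) = lam * a i" and nz: "i0 < n" "a i0 \<noteq> 0"
    and z: "\<And>i. i < n \<Longrightarrow> (\<Sum>j<n. A $$ (i, j) * z j) = lam * z i"
  obtains c where "\<And>i. i < n \<Longrightarrow> z i = c * a i"
proof -
  obtain m :: "nat \<Rightarrow> nat \<Rightarrow> complex" and R :: "nat \<Rightarrow> nat \<Rightarrow> complex poly" and q :: "complex poly"
    where q: "poly q lam \<noteq> 0"
      and mR: "\<And>i b \<mu>. i < n \<Longrightarrow> (\<Sum>k<n. m i k * b k) +
           (\<Sum>k<n. poly (R i k) \<mu> * (\<mu> * b k - (\<Sum>j<n. A $$ (k, j) * b j))) = poly q \<mu> * b i"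
      and Am: "\<And>i k. i < n \<Longrightarrow> k < n \<Longrightarrow> (\<Sum>j<n. A $$ (i, j) * m j k) = lam * m i k"
      and m: "\<And>i k. i < n \<Longrightarrow> k < n \<Longrightarrow>
           m i k = (- 1) ^ (k + i) * Determinant.det (mat_delete (lam \<cdot>\<^sub>m 1\<^sub>m n - A) k i)"
    by (rule simple_eigenvalue_adjugate[OF A ord]) (rule that; assumption)
  \<comment> \<open>A kernel vector \<open>y \<noteq> 0\<close> vanishing at \<open>i0\<close> survives the deletion of column \<open>i0\<close>, so row \<open>i0\<close> of the
    adjugate \<open>m\<close> vanishes; but \<open>m a = q(\<lambda>) a\<close>.\<close>
  define c where "c = z i0 / a i0"
  define y where "y i = z i - c * a i" for i
  have y: "(\<Sum>j<n. A $$ (i, j) * y j) = lam * y i" if "i < n" for i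
  proof -
    have "(\<Sum>j<n. A $$ (i, j) * y j) = (\<Sum>j<n. A $$ (i, j) * z j) - c * (\<Sum>j<n. A $$ (i, j) * a j)"
      by (simp add: y_def right_diff_distrib sum_subtractf sum_distrib_left mult.left_commute)
    then show ?thesis
      unfolding a[OF that] z[OF that] by (simp add: y_def right_diff_distrib mult.left_commute)
  qed
  have y0: "y i0 = 0" using nz by (simp add: y_def c_def)
  have "y i = 0" if i: "i < n" for i
  proof (rule ccontr)
    assume yi: "y i \<noteq> 0"
    define w where "w = Matrix.vec (n - 1) (\<lambda>j. y (insert_index i0 j))"
    have img: "insert_index i0 ` {0..<n - 1} = {0..<n} - {i0}"
      using insert_index_image[of i0 "n - 1"] nz by simp
    obtain j where j: "j < n - 1" "insert_index i0 j = i"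
    proof -
      have "i \<in> insert_index i0 ` {0..<n - 1}" unfolding img using i yi y0 by auto
      then show thesis using that by auto
    qed
    have "Determinant.det (mat_delete (lam \<cdot>\<^sub>m 1\<^sub>m n - A) k i0) = 0" if k: "k < n" for k
    proof -
      define C where "C = mat_delete (lam \<cdot>\<^sub>m 1\<^sub>m n - A) k i0"
      have C: "C \<in> carrier_mat (n - 1) (n - 1)"
        unfolding C_def by (rule mat_delete_carrier) (use A in auto)
      have w: "w \<in> carrier_vec (n - 1)" by (simp add: w_def)
      have "w \<noteq> 0\<^sub>v (n - 1)"
      proof
        assume "w = 0\<^sub>v (n - 1)"
        then have "vec_index w j = 0" using j by simp
        then show False using yi j by (simp add: w_def)
      qed
      moreover have "C *\<^sub>v w = 0\<^sub>v (n - 1)"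
      proof (rule eq_vecI)
        fix r assume "r < dim_vec (0\<^sub>v (n - 1) :: complex vec)"
        then have r: "r < n - 1" by simp
        define r' where "r' = insert_index k r"
        have r': "r' < n" using r by (auto simp: r'_def insert_index_def)
        have C_entry: "C $$ (r, j) = (if r' = insert_index i0 j then lam else 0) - A $$ (r', insert_index i0 j)"
          if "j < n - 1" for j
        proof -
          have "insert_index i0 j < n" using that by (auto simp: insert_index_def)
          then show ?thesis using r r' that A
            unfolding C_def mat_delete_def r'_def by (simp add: insert_index_def)
        qed
        have "vec_index (C *\<^sub>v w) r = (\<Sum>j\<in>{0..<n - 1}. C $$ (r, j) * y (insert_index i0 j))"
          using C r by (simp add: scalar_prod_def w_def)
        also have "\<dots> = (\<Sum>j\<in>{0..<n - 1}. (((if r' = insert_index i0 j then lam else 0)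
            - A $$ (r', insert_index i0 j)) * y (insert_index i0 j)))"
          by (intro sum.cong) (auto simp: C_entry)
        \<comment> \<open>Reindexing undoes the deletion of column \<open>i0\<close>; the missing
          summand carries the factor \<open>y i0 = 0\<close>.\<close>
        also have "\<dots> = (\<Sum>j\<in>insert_index i0 ` {0..<n - 1}. ((if r' = j then lam else 0) - A $$ (r', j)) * y j)"
          by (subst sum.reindex) (auto simp: insert_index_inj_on)
        also have "\<dots> = (\<Sum>j<n. ((if r' = j then lam else 0) - A $$ (r', j)) * y j)"
          unfolding img by (rule sum.mono_neutral_left) (auto simp: y0)
        also have "\<dots> = lam * y r' - (\<Sum>j<n. A $$ (r', j) * y j)"
          using r' by (simp add: left_diff_distrib sum_subtractf if_distrib[of "\<lambda>t. t * _"] cong: if_cong)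
        also have "\<dots> = 0" using y[OF r'] by simp
        finally show "vec_index (C *\<^sub>v w) r = vec_index (0\<^sub>v (n - 1)) r" using r by simp
      qed (use C in simp)
      ultimately show ?thesis
        using det_0_iff_vec_prod_zero[OF C] w unfolding C_def by blast
    qed
    then have "(\<Sum>k<n. m i0 k * a k) = 0" using nz by (simp add: m)
    moreover have "(\<Sum>k<n. m i0 k * a k) = poly q lam * a i0"
      using mR[OF nz(1), of a lam] a by simp
    ultimately show False using q nz by simp
  qed
  then show thesis using that[of c] by (simp add: y_def)
qed

text \<open>The adjugate identity writes \<open>q(\<mu>) b\<close> as \<open>m b\<close>, a multiple
  of \<open>a\<close>, plus \<open>R(\<mu>)\<close> applied to the residual. Near \<open>lam\<close>
  both \<open>R\<close> and \<open>1 / q\<close> are bounded, so \<open>K\<close> can be chosen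
  uniformly in \<open>\<mu>\<close> and \<open>b\<close>.\<close>

lemma simple_eigenvalue_perturbation:
  fixes A :: "complex mat"
  assumes A: "A \<in> carrier_mat n n" and ord: "Polynomial.order lam (char_poly A) = 1"
    and a: "\<And>i. i < n \<Longrightarrow> (\<Sum>j<n. A $$ (i, j) * a j) = lam * a i" and nz: "i0 < n" "a i0 \<noteq> 0"
  obtains K where "0 \<le> K" and "\<forall>\<^sub>F \<mu> in nhds lam. \<forall>b \<eta>.
    (\<forall>i<n. cmod ((\<Sum>j<n. A $$ (i, j) * b j) - \<mu> * b i) \<le> \<eta>) \<longrightarrow>
    (\<exists>c. \<forall>i<n. cmod (b i - c * a i) \<le> K * \<eta>)"
proof -
  obtain m :: "nat \<Rightarrow> nat \<Rightarrow> complex" and R :: "nat \<Rightarrow> nat \<Rightarrow> complex poly" and q :: "complex poly"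
    where q: "poly q lam \<noteq> 0"
      and mR: "\<And>i b \<mu>. i < n \<Longrightarrow> (\<Sum>k<n. m i k * b k) +
           (\<Sum>k<n. poly (R i k) \<mu> * (\<mu> * b k - (\<Sum>j<n. A $$ (k, j) * b j))) = poly q \<mu> * b i"
      and Am: "\<And>i k. i < n \<Longrightarrow> k < n \<Longrightarrow> (\<Sum>j<n. A $$ (i, j) * m j k) = lam * m i k"
      and m: "\<And>i k. i < n \<Longrightarrow> k < n \<Longrightarrow>
           m i k = (- 1) ^ (k + i) * Determinant.det (mat_delete (lam \<cdot>\<^sub>m 1\<^sub>m n - A) k i)"
    by (rule simple_eigenvalue_adjugate[OF A ord]) (rule that; assumption)
  \<comment> \<open>Adding one leaves room for continuity: near \<open>lam\<close> the entries of
    \<open>R\<close> stay below \<open>r\<close>. The factor 2 in \<open>K\<close> arises because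
    \<open>q\<close> keeps more than half of its modulus.\<close>
  define r where "r i k = cmod (poly (R i k) lam) + 1" for i k
  define S where "S = (\<Sum>i<n. \<Sum>k<n. r i k)"
  define K where "K = 2 / cmod (poly q lam) * S"
  have r0: "0 \<le> r i k" for i k by (simp add: r_def)
  have K0: "0 \<le> K" unfolding K_def S_def by (intro mult_nonneg_nonneg sum_nonneg r0) auto
  have cont: "((\<lambda>x. cmod (poly P x)) \<longlongrightarrow> cmod (poly P lam)) (nhds lam)" for P :: "complex poly"
    by (intro tendsto_intros filterlim_ident)
  have "\<forall>\<^sub>F \<mu> in nhds lam. \<forall>i\<in>{..<n}. \<forall>k\<in>{..<n}. cmod (poly (R i k) \<mu>) < r i k"
    by (intro eventually_ball_finite ballI order_tendstoD(2)[OF cont]) (auto simp: r_def)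
  moreover have "\<forall>\<^sub>F \<mu> in nhds lam. cmod (poly q lam) / 2 < cmod (poly q \<mu>)"
    by (rule order_tendstoD(1)[OF cont]) (use q in simp)
  ultimately have "\<forall>\<^sub>F \<mu> in nhds lam. \<forall>b \<eta>.
    (\<forall>i<n. cmod ((\<Sum>j<n. A $$ (i, j) * b j) - \<mu> * b i) \<le> \<eta>) \<longrightarrow>
    (\<exists>c. \<forall>i<n. cmod (b i - c * a i) \<le> K * \<eta>)"
  proof eventually_elim
    case (elim \<mu>)
    have q\<mu>: "cmod (poly q \<mu>) > 0" using elim(2) by (rule le_less_trans[rotated]) simp
    show ?case
    proof (intro allI impI)
      fix b \<eta> assume res: "\<forall>i<n. cmod ((\<Sum>j<n. A $$ (i, j) * b j) - \<mu> * b i) \<le> \<eta>"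
      have \<eta>: "0 \<le> \<eta>" using res nz norm_ge_zero order_trans by blast
      define z where "z i = (\<Sum>k<n. m i k * b k)" for i
      have "(\<Sum>j<n. A $$ (i, j) * z j) = lam * z i" if "i < n" for i
      proof -
        have "(\<Sum>j<n. A $$ (i, j) * z j) = (\<Sum>k<n. (\<Sum>j<n. A $$ (i, j) * m j k) * b k)"
          unfolding z_def sum_distrib_left sum_distrib_right by (subst sum.swap) (simp add: mult.assoc)
        also have "\<dots> = (\<Sum>k<n. lam * m i k * b k)" using that by (intro sum.cong) (auto simp: Am)
        finally show ?thesis by (simp add: z_def sum_distrib_left mult.assoc)
      qed
      then obtain c where c: "\<And>i. i < n \<Longrightarrow> z i = c * a i"
        using simple_eigenvalue_kernel[OF A ord a nz] by metis
      \<comment> \<open>\<open>m b\<close> is \<open>c\<close> times \<open>a\<close>, and the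
        identity must still be divided by the value of \<open>q\<close> at \<open>\<mu>\<close>;
        what remains is the residual part \<open>s\<close>.\<close>
      have "cmod (b i - c / poly q \<mu> * a i) \<le> K * \<eta>" if i: "i < n" for i
      proof -
        define s where "s = (\<Sum>k<n. poly (R i k) \<mu> * (\<mu> * b k - (\<Sum>j<n. A $$ (k, j) * b j)))"
        have "z i + s = poly q \<mu> * b i"
          unfolding z_def s_def by (rule mR[OF i])
        then have eq: "b i - c / poly q \<mu> * a i = s / poly q \<mu>"
          using q\<mu> c[OF i] by (simp add: field_simps)
        have "cmod s \<le> (\<Sum>k<n. r i k * \<eta>)"
          unfolding s_def
        proof (intro sum_norm_le)
          fix k assume "k \<in> {..<n}"
          then have "cmod (poly (R i k) \<mu>) \<le> r i k"
              "cmod (\<mu> * b k - (\<Sum>j<n. A $$ (k, j) * b j)) \<le> \<eta>"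
            using elim(1) i res by (auto simp: norm_minus_commute less_imp_le)
          then show "cmod (poly (R i k) \<mu> * (\<mu> * b k - (\<Sum>j<n. A $$ (k, j) * b j))) \<le> r i k * \<eta>"
            unfolding norm_mult by (intro mult_mono r0) auto
        qed
        also have "\<dots> \<le> S * \<eta>"
          unfolding S_def sum_distrib_right[symmetric] using i \<eta>
          by (intro mult_right_mono member_le_sum[where f = "\<lambda>i. \<Sum>k<n. r i k"] sum_nonneg r0) auto
        finally have s: "cmod s \<le> S * \<eta>" .
        have "cmod (s / poly q \<mu>) \<le> S * \<eta> / (cmod (poly q lam) / 2)"
          unfolding norm_divide using elim(2) s q order_trans[OF norm_ge_zero s] by (intro frac_le) auto
        then show ?thesis unfolding eq K_def by (simp add: mult_ac)
      qed
      then show "\<exists>c. \<forall>i<n. cmod (b i - c * a i) \<le> K * \<eta>" by blast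
    qed
  qed
  with K0 that show thesis by blast
qed

section \<open>Chains and capacitance potentials\<close>

locale periodic_chain =
  fixes N :: nat and L :: real and xL xR :: "int \<Rightarrow> real"
  assumes chain: "chain N L xL xR"
begin

section \<open>Periodicity of endpoints and indices\<close>

lemma N_pos: "0 < int N" and xL_1: "xL 1 = 0"
  using chain by (auto simp: chain_def)

lemma xL_shift: "xL (i + m * int N) = xL i + of_int m * L"
proof (induction m rule: int_induct[of _ 0])
  case (step1 m)
  have "xL (i + (m + 1) * int N) = xL ((i + m * int N) + int N)" by (simp add: algebra_simps)
  also have "\<dots> = xL (i + m * int N) + L" using chain unfolding chain_def by blast
  finally show ?case using step1 by (simp add: algebra_simps)
next
  case (step2 m)
  have "xL ((i + (m - 1) * int N) + int N) = xL (i + (m - 1) * int N) + L"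
    using chain unfolding chain_def by blast
  then show ?case using step2 by (simp add: algebra_simps)
qed simp

lemma xR_shift: "xR (i + m * int N) = xR i + of_int m * L"
proof (induction m rule: int_induct[of _ 0])
  case (step1 m)
  have "xR (i + (m + 1) * int N) = xR ((i + m * int N) + int N)" by (simp add: algebra_simps)
  also have "\<dots> = xR (i + m * int N) + L" using chain unfolding chain_def by blast
  finally show ?case using step1 by (simp add: algebra_simps)
next
  case (step2 m)
  have "xR ((i + (m - 1) * int N) + int N) = xR (i + (m - 1) * int N) + L"
    using chain unfolding chain_def by blast
  then show ?case using step2 by (simp add: algebra_simps)
qed simp

text \<open>Division with remainder, shifted by one because the fundamental cell is numbered from
  \<open>1\<close> to \<open>N\<close>; \<open>cell\<close> is the representative there and
  \<open>turn\<close> counts periods.\<close>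

definition cell :: "int \<Rightarrow> int" where "cell i = (i - 1) mod int N + 1"

definition turn :: "int \<Rightarrow> int" where "turn i = (i - 1) div int N"

lemma cell_turn: "cell i + turn i * int N = i"
  unfolding cell_def turn_def by (metis add.commute add.left_commute diff_add_cancel mod_div_mult_eq)

lemma cell_range: "cell i \<in> {1..int N}"
  using pos_mod_sign[OF N_pos, of "i - 1"] pos_mod_bound[OF N_pos, of "i - 1"]
  unfolding cell_def atLeastAtMost_iff by linarith

lemma cell_turn_eq:
  assumes "j \<in> {1..int N}"
  shows "cell (j + m * int N) = j" "turn (j + m * int N) = m"
proof -
  have eq: "j + m * int N - 1 = (j - 1) + m * int N" by simp
  have j: "0 \<le> j - 1" "j - 1 < int N" using assms by auto
  show "cell (j + m * int N) = j"
    unfolding cell_def eq mod_mult_self1 using mod_pos_pos_trivial[OF j] by simp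
  show "turn (j + m * int N) = m"
    unfolding turn_def eq using div_mult_self1[of "int N" "j - 1" m] N_pos div_pos_pos_trivial[OF j]
    by simp
qed

lemma cell_shift: "cell (i + m * int N) = cell i" and turn_shift: "turn (i + m * int N) = turn i + m"
proof -
  have "i + m * int N = cell i + (turn i + m) * int N"
    using cell_turn[of i] by (simp add: distrib_right)
  then show "cell (i + m * int N) = cell i" "turn (i + m * int N) = turn i + m"
    using cell_turn_eq[OF cell_range[of i], of "turn i + m"] by auto
qed

lemma xL_less_xR: "xL i < xR i"
proof -
  have "xL (cell i) < xR (cell i)" using chain cell_range[of i] by (auto simp: chain_def)
  then show ?thesis using xL_shift[of "cell i" "turn i"] xR_shift[of "cell i" "turn i"] cell_turn by simp
qed

lemma xR_less_xL: "xR i < xL (i + 1)"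
proof -
  have "xR (cell i) < xL (cell i + 1)"
  proof (cases "cell i = int N")
    \<comment> \<open>The gap after resonator \<open>N\<close> crosses the period boundary; it has
      positive length because \<open>L\<close> exceeds \<open>xR (int N) - xL 1\<close>.\<close>
    case True
    then show ?thesis
      using chain xL_shift[of 1 1] by (simp add: chain_def add.commute)
  next
    case False
    then have "cell i \<in> {1..<int N}" using cell_range[of i] by auto
    then show ?thesis using chain by (auto simp: chain_def)
  qed
  moreover have "xL (i + 1) = xL (cell i + 1) + of_int (turn i) * L"
    using xL_shift[of "cell i + 1" "turn i"] cell_turn[of i] by (simp add: algebra_simps)
  ultimately show ?thesis using xR_shift[of "cell i" "turn i"] cell_turn[of i] by simp
qed

section \<open>Ordering of the endpoints and location of points\<close>

lemma xL_step: "xL i < xL (i + 1)"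
  using xL_less_xR[of i] xR_less_xL[of i] by simp

lemma xL_less:
  assumes "i < j" shows "xL i < xL j"
proof -
  obtain n where n: "j = i + int (Suc n)" using assms zless_iff_Suc_zadd by blast
  have "xL i < xL (i + int (Suc n))"
  proof (induction n)
    case 0 then show ?case using xL_step[of i] by simp
  next
    case (Suc n)
    have "i + int (Suc (Suc n)) = i + int (Suc n) + 1" by simp
    then show ?case using less_trans[OF Suc xL_step] by (simp only:)
  qed
  then show ?thesis by (simp add: n)
qed

lemma xL_le: "i \<le> j \<Longrightarrow> xL i \<le> xL j"
  using xL_less[of i j] by (cases "i = j") auto

lemma xL_cell_le: "xL (i + 1) \<le> xL i + L"
  using xL_le[of "i + 1" "i + int N"] xL_shift[of i 1] N_pos by simp

lemma L_pos: "0 < L"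
  using xL_cell_le[of 0] xL_step[of 0] by simp

text \<open>Translation by whole periods brings \<open>x\<close> into \<open>[0, L)\<close>; there
  the largest left endpoint not exceeding it gives the index, and \<open>xL 1 = 0\<close> guarantees
  that there is one.\<close>

lemma ex_idx: "\<exists>i. xL i \<le> x \<and> x < xL (i + 1)"
proof -
  define m where "m = \<lfloor>x / L\<rfloor>"
  define y where "y = x - of_int m * L"
  have y: "0 \<le> y" "y < L"
    using L_pos floor_divide_lower[OF L_pos, of x] floor_divide_upper[OF L_pos, of x]
    by (auto simp: y_def m_def algebra_simps)
  define k where "k = Max {i \<in> {1..int N}. xL i \<le> y}"
  have fin: "finite {i \<in> {1..int N}. xL i \<le> y}" by (rule finite_Collect_conjI) simp
  have "k \<in> {i \<in> {1..int N}. xL i \<le> y}"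
    unfolding k_def using fin by (rule Max_in) (use xL_1 y N_pos in \<open>auto intro!: exI[of _ 1]\<close>)
  then have k: "1 \<le> k" "k \<le> int N" "xL k \<le> y" by auto
  have "y < xL (k + 1)"
  proof (cases "k = int N")
    case True
    then show ?thesis using y xL_shift[of 1 1] xL_1 by (simp add: add.commute)
  next
    case False
    show ?thesis
    proof (rule ccontr)
      assume "\<not> y < xL (k + 1)"
      then have "k + 1 \<le> k" unfolding k_def using fin False k k_def by (intro Max_ge) auto
      then show False by simp
    qed
  qed
  moreover have "xL (k + m * int N + 1) = xL (k + 1) + of_int m * L"
    using xL_shift[of "k + 1" m] by (simp add: algebra_simps)
  ultimately show ?thesis
    using k xL_shift[of k m] by (intro exI[of _ "k + m * int N"]) (simp add: y_def)
qed

text \<open>The half-open pieces, each a resonator with the gap after it, tile the line, so the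
  description is met by exactly one index.\<close>

definition idx :: "real \<Rightarrow> int" where
  "idx x = (THE i. xL i \<le> x \<and> x < xL (i + 1))"

lemma idx_eq:
  assumes "xL i \<le> x" "x < xL (i + 1)" shows "idx x = i"
  unfolding idx_def
proof (rule the_equality)
  fix j assume j: "xL j \<le> x \<and> x < xL (j + 1)"
  show "j = i"
  proof (rule ccontr)
    assume "j \<noteq> i"
    then have "j + 1 \<le> i \<or> i + 1 \<le> j" by auto
    then show False using xL_le[of "j + 1" i] xL_le[of "i + 1" j] assms j by auto
  qed
qed (use assms in simp)

lemma idx: "xL (idx x) \<le> x" "x < xL (idx x + 1)"
  using ex_idx[of x] idx_eq by blast+

lemma resonator_or_gap:
  obtains i where "xL i \<le> x" "x \<le> xR i" | i where "xR i < x" "x < xL (i + 1)"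
proof (cases "x \<le> xR (idx x)")
  case True
  then show thesis using idx(1)[of x] by (rule that(1)[rotated])
next
  case False
  then have "xR (idx x) < x" by simp
  then show thesis using idx(2)[of x] by (rule that(2))
qed

lemma idx_shift: "idx (x + of_int m * L) = idx x + m * int N"
  using idx[of x] xL_shift[of "idx x" m] xL_shift[of "idx x + 1" m]
  by (intro idx_eq) (auto simp: algebra_simps)

text \<open>The closure of an infinite union need not be the union of the closures. Instead, the
  union of the gaps is open and misses the crystal, hence it also misses the closure.\<close>

lemma complement_closure_crystal:
  "- closure (crystal xL xR) = (\<Union>i. {xR i<..<xL (i + 1)})"
proof (intro equalityI subsetI)
  fix x assume x: "x \<in> - closure (crystal xL xR)"
  have "x \<notin> {xL i..xR i}" for i
  proof -
    have "closure (resonator xL xR i) \<subseteq> closure (crystal xL xR)"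
      by (intro closure_mono) (auto simp: crystal_def)
    then show ?thesis using x xL_less_xR[of i] by (auto simp: resonator_def)
  qed
  then show "x \<in> (\<Union>i. {xR i<..<xL (i + 1)})"
    by (cases rule: resonator_or_gap[of x]) auto
next
  fix x assume "x \<in> (\<Union>i. {xR i<..<xL (i + 1)})"
  moreover have "(\<Union>i. {xR i<..<xL (i + 1)}) \<inter> crystal xL xR = {}"
  proof -
    have False if "xR i < y" "y < xL (i + 1)" "xL j < y" "y < xR j" for i j y
    proof -
      have "idx y = i" using that xL_less_xR[of i] by (intro idx_eq) auto
      moreover have "idx y = j" using that xR_less_xL[of j] by (intro idx_eq) auto
      ultimately show False using that by simp
    qed
    then show ?thesis by (auto simp: crystal_def resonator_def)
  qed
  then have "(\<Union>i. {xR i<..<xL (i + 1)}) \<inter> closure (crystal xL xR) = {}"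
    by (subst open_Int_closure_eq_empty) auto
  ultimately show "x \<in> - closure (crystal xL xR)" by blast
qed

lemma gap_subset: "{xR i<..<xL (i + 1)} \<subseteq> - closure (crystal xL xR)"
  unfolding complement_closure_crystal by blast

text \<open>
  The function \<open>interp b\<close> equals \<open>b i\<close> on resonator \<open>i\<close> and is affine with slope \<open>slope b i\<close> on the
  gap that follows it; \<open>max 0\<close> makes the interpolation weight vanish on the resonator.
\<close>

definition slope :: "(int \<Rightarrow> complex) \<Rightarrow> int \<Rightarrow> complex" where
  "slope b i = (b (i + 1) - b i) / of_real (xL (i + 1) - xR i)"

definition gap_fraction :: "real \<Rightarrow> real" where
  "gap_fraction x = max 0 ((x - xR (idx x)) / (xL (idx x + 1) - xR (idx x)))"

definition interp :: "(int \<Rightarrow> complex) \<Rightarrow> real \<Rightarrow> complex" where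
  "interp b x = (1 - of_real (gap_fraction x)) * b (idx x) + of_real (gap_fraction x) * b (idx x + 1)"

section \<open>Values, continuity and harmonicity of the interpolant\<close>

lemma gap_fraction_range: "0 \<le> gap_fraction x" "gap_fraction x \<le> 1"
  using idx[of x] xR_less_xL[of "idx x"] by (auto simp: gap_fraction_def divide_le_eq)

lemma interp_resonator:
  assumes "xL i \<le> x" "x \<le> xR i" shows "interp b x = b i"
proof -
  have i: "idx x = i" using assms xR_less_xL[of i] by (intro idx_eq) auto
  have "(x - xR i) / (xL (i + 1) - xR i) \<le> 0"
    using assms xR_less_xL[of i] by (intro divide_nonpos_pos) auto
  then show ?thesis by (simp add: interp_def gap_fraction_def i)
qed

lemma interp_gap:
  assumes "xR i \<le> x" "x \<le> xL (i + 1)"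
  shows "interp b x = b i + of_real (x - xR i) * slope b i"
proof (cases "x = xL (i + 1)")
  \<comment> \<open>At the right end of the gap \<open>idx\<close> has already jumped to
    \<open>i + 1\<close>, so the value comes from the next resonator.\<close>
  case True
  then show ?thesis
    using interp_resonator[of "i + 1" x b] xL_less_xR[of "i + 1"] xR_less_xL[of i]
    by (simp add: slope_def flip: of_real_diff)
next
  case False
  have i: "idx x = i" using assms False xL_less_xR[of i] by (intro idx_eq) auto
  have "gap_fraction x = (x - xR i) / (xL (i + 1) - xR i)"
    using assms xR_less_xL[of i] by (simp add: gap_fraction_def i)
  moreover have "interp b x = b i + of_real (gap_fraction x) * (b (i + 1) - b i)"
    by (simp add: interp_def i algebra_simps)
  ultimately show ?thesis by (simp add: slope_def)
qed

lemma interp_sum: "interp (\<lambda>i. \<Sum>j\<in>S. f j * b j i) x = (\<Sum>j\<in>S. f j * interp (b j) x)"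
  by (simp add: interp_def sum_distrib_left sum.distrib distrib_left mult_ac)

lemma interp_diff_scaled: "interp (\<lambda>i. b i - c * d i) x = interp b x - c * interp d x"
  by (simp add: interp_def algebra_simps)

lemma norm_interp_le:
  assumes "\<And>i. cmod (b i) \<le> B" shows "cmod (interp b x) \<le> B"
proof -
  have "cmod (interp b x) \<le> cmod (of_real (1 - gap_fraction x) * b (idx x))
      + cmod (of_real (gap_fraction x) * b (idx x + 1))"
    unfolding interp_def of_real_diff of_real_1 by (rule norm_triangle_ineq)
  also have "\<dots> \<le> (1 - gap_fraction x) * B + gap_fraction x * B"
    unfolding norm_mult norm_of_real using gap_fraction_range[of x] assms
    by (intro add_mono mult_mono) auto
  finally show ?thesis by (simp add: algebra_simps)
qed

lemma continuous_on_interp: "continuous_on UNIV (interp b)"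
proof -
  have *: "continuous_on {xL i..xL (i + 1)} (interp b)" for i
  proof -
    have "continuous_on {xL i..xR i} (interp b) \<longleftrightarrow> continuous_on {xL i..xR i} (\<lambda>_. b i)"
      by (intro continuous_on_cong refl interp_resonator) auto
    moreover have "continuous_on {xR i..xL (i + 1)} (interp b) \<longleftrightarrow>
        continuous_on {xR i..xL (i + 1)} (\<lambda>x. b i + of_real (x - xR i) * slope b i)"
      by (intro continuous_on_cong refl interp_gap) auto
    ultimately have "continuous_on ({xL i..xR i} \<union> {xR i..xL (i + 1)}) (interp b)"
      by (intro continuous_on_closed_Un) (auto intro!: continuous_intros)
    moreover have "{xL i..xR i} \<union> {xR i..xL (i + 1)} = {xL i..xL (i + 1)}"
      using xL_less_xR[of i] xR_less_xL[of i] by (intro ivl_disj_un_two_touch) auto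
    ultimately show ?thesis by simp
  qed
  have "isCont (interp b) x" for x
  proof -
    define i where "i = idx x"
    \<comment> \<open>\<open>x\<close> may coincide with \<open>xL i\<close>, where two pieces meet;
      joining the preceding piece makes it an interior point.\<close>
    have "continuous_on ({xL (i - 1)..xL (i - 1 + 1)} \<union> {xL i..xL (i + 1)}) (interp b)"
      by (intro continuous_on_closed_Un * closed_atLeastAtMost)
    moreover have "{xL (i - 1)..xL (i - 1 + 1)} \<union> {xL i..xL (i + 1)} = {xL (i - 1)..xL (i + 1)}"
      using xL_step[of "i - 1"] xL_step[of i] by auto
    ultimately have "continuous_on {xL (i - 1)..xL (i + 1)} (interp b)" by simp
    moreover have "x \<in> interior {xL (i - 1)..xL (i + 1)}"
      using idx[of x] xL_step[of "i - 1"] by (auto simp: i_def)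
    ultimately show ?thesis by (rule continuous_on_interior)
  qed
  then show ?thesis by (simp add: continuous_on_eq_continuous_at)
qed

lemma helmholtz_interp: "helmholtz_on 0 (interp b) (- closure (crystal xL xR))"
  unfolding helmholtz_on_def complement_closure_crystal
proof (intro exI ballI)
  fix x assume "x \<in> (\<Union>i. {xR i<..<xL (i + 1)})"
  then obtain i where x: "x \<in> {xR i<..<xL (i + 1)}" by blast
  have idx_i: "idx y = i" if "y \<in> {xR i<..<xL (i + 1)}" for y
    using that xL_less_xR[of i] by (intro idx_eq) auto
  have "((\<lambda>x. b i + of_real (x - xR i) * slope b i) has_vector_derivative slope b i) (at x)"
    by (auto intro!: derivative_eq_intros)
  then have "(interp b has_vector_derivative slope b i) (at x)"
    by (rule has_vector_derivative_transform_within_open[where S = "{xR i<..<xL (i + 1)}"])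
       (use x in \<open>auto simp: interp_gap[of i]\<close>)
  moreover have "((\<lambda>x. slope b (idx x)) has_vector_derivative 0) (at x)"
    by (rule has_vector_derivative_transform_within_open[where S = "{xR i<..<xL (i + 1)}"
          and f = "\<lambda>_. slope b i"]) (use x idx_i in auto)
  ultimately show "(interp b has_vector_derivative slope b (idx x)) (at x) \<and>
      ((\<lambda>x. slope b (idx x)) has_vector_derivative - 0 * interp b x) (at x)"
    by (simp add: idx_i[OF x])
qed

lemma deriv_interp:
  "deriv_right (interp b) (xR i) = slope b i" "deriv_left (interp b) (xL (i + 1)) = slope b i"
proof -
  have hh: "helmholtz_on 0 (interp b) {xR i<..<xL (i + 1)}"
    by (rule helmholtz_on_subset[OF helmholtz_interp gap_subset])
  have "interp b (xR i) = b i" "interp b (xL (i + 1)) = b (i + 1)"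
    by (rule interp_resonator[OF less_imp_le[OF xL_less_xR] order_refl]
        interp_resonator[OF order_refl less_imp_le[OF xL_less_xR]])+
  then show "deriv_right (interp b) (xR i) = slope b i" "deriv_left (interp b) (xL (i + 1)) = slope b i"
    using harmonic_interval(1,2)[OF xR_less_xL hh continuous_on_subset[OF continuous_on_interp]]
    by (auto simp: slope_def)
qed

section \<open>Quasiperiodic sequences and capacitance potentials\<close>

definition quasiperiodic :: "real \<Rightarrow> (int \<Rightarrow> complex) \<Rightarrow> bool" where
  "quasiperiodic \<alpha> b \<longleftrightarrow> (\<forall>i m. b (i + m * int N) = cis (\<alpha> * of_int m * L) * b i)"

text \<open>The quasiperiodic extension of the \<open>j\<close>-th unit vector, that is, the values
  of the capacitance potential with index \<open>j\<close> on all resonators.\<close>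

definition unit_seq :: "real \<Rightarrow> int \<Rightarrow> int \<Rightarrow> complex" where
  "unit_seq \<alpha> j i = (if cell i = j then cis (\<alpha> * of_int (turn i) * L) else 0)"

lemma quasiperiodic_unit_seq: "quasiperiodic \<alpha> (unit_seq \<alpha> j)"
  by (simp add: quasiperiodic_def unit_seq_def cell_shift turn_shift cis_mult algebra_simps)

lemma quasiperiodic_cell:
  "quasiperiodic \<alpha> b \<Longrightarrow> b i = cis (\<alpha> * of_int (turn i) * L) * b (cell i)"
  unfolding quasiperiodic_def by (metis cell_turn)

lemma quasiperiodic_norm:
  assumes "quasiperiodic \<alpha> b" shows "cmod (b i) = cmod (b (cell i))"
  by (subst quasiperiodic_cell[OF assms]) (simp add: norm_mult)

text \<open>The \<open>N\<close> values in the fundamental cell determine the sequence. This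
  identifies quasiperiodic sequences with coefficient vectors, position \<open>j\<close> standing
  for resonator \<open>int j + 1\<close>.\<close>

lemma quasiperiodic_expansion:
  assumes "quasiperiodic \<alpha> b"
  shows "b i = (\<Sum>j<N. b (int j + 1) * unit_seq \<alpha> (int j + 1) i)"
proof -
  define k where "k = nat (cell i - 1)"
  have k: "int k + 1 = cell i" "k < N" using cell_range[of i] by (auto simp: k_def)
  have "(\<Sum>j<N. b (int j + 1) * unit_seq \<alpha> (int j + 1) i)
      = (\<Sum>j<N. if j = k then b (cell i) * cis (\<alpha> * of_int (turn i) * L) else 0)"
    using k by (intro sum.cong) (auto simp: unit_seq_def)
  also have "\<dots> = b i" using k quasiperiodic_cell[OF assms, of i] by simp
  finally show ?thesis ..
qed

lemma interp_shift:
  assumes "quasiperiodic \<alpha> b"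
  shows "interp b (x + of_int m * L) = cis (\<alpha> * of_int m * L) * interp b x"
proof -
  have b: "b (idx x + m * int N) = cis (\<alpha> * of_int m * L) * b (idx x)"
    "b (idx x + m * int N + 1) = cis (\<alpha> * of_int m * L) * b (idx x + 1)"
    using assms[unfolded quasiperiodic_def, rule_format, of "idx x" m]
      assms[unfolded quasiperiodic_def, rule_format, of "idx x + 1" m] by (simp_all add: ac_simps)
  have "xL (idx x + m * int N + 1) = xL (idx x + 1) + of_int m * L"
    using xL_shift[of "idx x + 1" m] by (simp add: ac_simps)
  then have gf: "gap_fraction (x + of_int m * L) = gap_fraction x"
    by (simp add: gap_fraction_def idx_shift xR_shift)
  show ?thesis unfolding interp_def idx_shift b gf by (simp add: algebra_simps)
qed

lemma is_cap_potential_interp: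
  assumes "j \<in> {1..int N}"
  shows "is_cap_potential N L xL xR \<alpha> j (interp (unit_seq \<alpha> j))"
  unfolding is_cap_potential_def
proof (intro conjI ballI allI continuous_on_interp helmholtz_interp)
  fix i x assume "i \<in> {1..int N}" "x \<in> resonator xL xR i"
  then show "interp (unit_seq \<alpha> j) x = (if i = j then 1 else 0)"
    using interp_resonator[of i x "unit_seq \<alpha> j"] cell_turn_eq[of i 0]
    by (auto simp: resonator_def unit_seq_def)
qed (rule interp_shift[OF quasiperiodic_unit_seq])

text \<open>Quasiperiodicity fixes the values on every open resonator, continuity carries them to
  the endpoints, and in a gap a harmonic function is fixed by its two end values. This justifies the
  definite description in \<open>cap_potential\<close>.\<close>

lemma is_cap_potential_unique:
  assumes V: "is_cap_potential N L xL xR \<alpha> j V"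
  shows "V = interp (unit_seq \<alpha> j)"
proof
  have cont: "continuous_on UNIV V" using V by (simp add: is_cap_potential_def)
  have res: "V x = unit_seq \<alpha> j i" if "xL i \<le> x" "x \<le> xR i" for x i
  proof -
    have "V y = unit_seq \<alpha> j i" if "y \<in> {xL i<..<xR i}" for y
    proof -
      define z where "z = y - of_int (turn i) * L"
      have "z \<in> resonator xL xR (cell i)"
        using that xL_shift[of "cell i" "turn i"] xR_shift[of "cell i" "turn i"]
        by (auto simp: resonator_def z_def cell_turn)
      then have "V z = (if cell i = j then 1 else 0)"
        using V cell_range[of i] by (auto simp: is_cap_potential_def)
      moreover have "V (z + of_int (turn i) * L) = cis (\<alpha> * of_int (turn i) * L) * V z"
        using V by (auto simp: is_cap_potential_def)
      ultimately show ?thesis by (simp add: z_def unit_seq_def)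
    qed
    then show ?thesis
      using continuous_constant_on_closure[OF continuous_on_subset[OF cont subset_UNIV], of "{xL i<..<xR i}"
          "unit_seq \<alpha> j i" x] xL_less_xR[of i] that by auto
  qed
  fix x show "V x = interp (unit_seq \<alpha> j) x"
  proof (cases rule: resonator_or_gap[of x])
    case (1 i)
    then show ?thesis using res[OF 1] interp_resonator[OF 1] by simp
  next
    case (2 i)
    have hh: "helmholtz_on 0 V {xR i<..<xL (i + 1)}"
      using V by (auto simp: is_cap_potential_def intro: helmholtz_on_subset[OF _ gap_subset])
    have "V (xR i) = unit_seq \<alpha> j i" "V (xL (i + 1)) = unit_seq \<alpha> j (i + 1)"
      by (rule res[OF less_imp_le[OF xL_less_xR] order_refl]
          res[OF order_refl less_imp_le[OF xL_less_xR]])+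
    moreover have "V x = V (xR i) + of_real (x - xR i) *
        ((V (xL (i + 1)) - V (xR i)) / of_real (xL (i + 1) - xR i))"
      using 2 by (intro harmonic_interval(3)[OF xR_less_xL hh continuous_on_subset[OF cont]]) auto
    ultimately show ?thesis using 2 by (simp add: interp_gap[of i] slope_def)
  qed
qed

lemma cap_potential_eq:
  assumes "j \<in> {1..int N}"
  shows "cap_potential N L xL xR \<alpha> j = interp (unit_seq \<alpha> j)"
  unfolding cap_potential_def
  using is_cap_potential_interp[OF assms] is_cap_potential_unique by (rule the_equality)

section \<open>Action of the generalised capacitance matrix\<close>

lemma slope_sum: "slope (\<lambda>i. \<Sum>j\<in>S. f j * b j i) i = (\<Sum>j\<in>S. f j * slope (b j) i)"
  unfolding slope_def sum_subtractf[symmetric] sum_divide_distrib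
  by (simp add: right_diff_distrib)

lemma gen_cap_matrix_carrier: "gen_cap_matrix N L xL xR vr \<alpha> \<in> carrier_mat N N"
  unfolding gen_cap_matrix_def
  by (intro mult_carrier_mat[of _ N N _ N] mat_diag_dim) (simp add: cap_matrix_def)

text \<open>Slopes are linear in the values on the resonators, so the matrix acts as a weighted
  difference of neighbouring gap slopes. Row \<open>i\<close> belongs to resonator
  \<open>i + 1\<close>, whose left gap has index \<open>i\<close> and whose right gap has index
  \<open>i + 1\<close>.\<close>

lemma gen_cap_matrix_apply:
  assumes b: "quasiperiodic \<alpha> b" and i: "i < N"
  shows "(\<Sum>j<N. gen_cap_matrix N L xL xR vr \<alpha> $$ (i, j) * b (int j + 1)) =
    (vr (int i + 1))\<^sup>2 / of_real (resonator_length xL xR (int i + 1)) *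
    (slope b (int i) - slope b (int i + 1))"
proof -
  define d where "d = (vr (int i + 1))\<^sup>2 / of_real (resonator_length xL xR (int i + 1))"
  have C: "cap_matrix N L xL xR \<alpha> \<in> carrier_mat N N" by (simp add: cap_matrix_def)
  have entry: "gen_cap_matrix N L xL xR vr \<alpha> $$ (i, j) =
      d * (slope (unit_seq \<alpha> (int j + 1)) (int i) - slope (unit_seq \<alpha> (int j + 1)) (int i + 1))"
    if j: "j < N" for j
  proof -
    have "gen_cap_matrix N L xL xR vr \<alpha> $$ (i, j) = d * cap_matrix N L xL xR \<alpha> $$ (i, j)"
      using i j C
      by (simp add: gen_cap_matrix_def d_def mat_diag_mult_left[where nr = N] divide_inverse mult.assoc
          assoc_mult_mat[of _ N N _ N _ N])
    also have "cap_matrix N L xL xR \<alpha> $$ (i, j) =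
        slope (unit_seq \<alpha> (int j + 1)) (int i) - slope (unit_seq \<alpha> (int j + 1)) (int i + 1)"
      using i j by (simp add: cap_matrix_def cap_potential_eq deriv_interp)
    finally show ?thesis .
  qed
  have eq: "b = (\<lambda>i. \<Sum>j<N. b (int j + 1) * unit_seq \<alpha> (int j + 1) i)"
    using quasiperiodic_expansion[OF b] by blast
  have s: "slope b k = (\<Sum>j<N. b (int j + 1) * slope (unit_seq \<alpha> (int j + 1)) k)" for k
    by (subst eq) (rule slope_sum)
  have "(\<Sum>j<N. gen_cap_matrix N L xL xR vr \<alpha> $$ (i, j) * b (int j + 1)) =
      (\<Sum>j<N. d * (b (int j + 1) * slope (unit_seq \<alpha> (int j + 1)) (int i))
           - d * (b (int j + 1) * slope (unit_seq \<alpha> (int j + 1)) (int i + 1)))"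
  proof (rule sum.cong)
    fix j assume "j \<in> {..<N}"
    then have "j < N" by simp
    show "gen_cap_matrix N L xL xR vr \<alpha> $$ (i, j) * b (int j + 1) =
        d * (b (int j + 1) * slope (unit_seq \<alpha> (int j + 1)) (int i))
           - d * (b (int j + 1) * slope (unit_seq \<alpha> (int j + 1)) (int i + 1))"
      unfolding entry[OF \<open>j < N\<close>] by (simp add: algebra_simps)
  qed simp
  also have "\<dots> = d * (slope b (int i) - slope b (int i + 1))"
    by (simp only: s sum_subtractf right_diff_distrib sum_distrib_left)
  finally show ?thesis by (simp add: d_def)
qed

section \<open>Resonant modes\<close>

text \<open>By periodicity at most \<open>N\<close> different gap lengths occur.\<close>

lemma gap_lower_bound: obtains \<sigma> where "0 < \<sigma>" "\<And>i. \<sigma> \<le> xL (i + 1) - xR i"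
proof
  define S where "S = (\<lambda>i. xL (i + 1) - xR i) ` {1..int N}"
  have S: "finite S" "S \<noteq> {}" using N_pos by (auto simp: S_def)
  show "0 < Min S" using S xR_less_xL by (auto simp: S_def)
  show "Min S \<le> xL (i + 1) - xR i" for i
  proof -
    have "xL (i + 1) = xL (cell i + 1) + of_int (turn i) * L"
      using xL_shift[of "cell i + 1" "turn i"] cell_turn[of i] by (simp add: algebra_simps)
    then have "xL (i + 1) - xR i = xL (cell i + 1) - xR (cell i)"
      using xR_shift[of "cell i" "turn i"] cell_turn[of i] by simp
    then show ?thesis using S cell_range[of i] by (auto simp: S_def intro!: Min_le)
  qed
qed

text \<open>The constants follow the argument. \<open>C1 * M\<close> bounds the slope at the right
  end of a gap: the chord gives \<open>2 / \<sigma>\<close>, the equation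
  \<open>\<kappa> * L\<close>. The jump condition scales the slope entering a resonator by
  \<open>\<delta>\<close>, so \<open>u\<close> varies there by at most
  \<open>C2 * \<delta> * M\<close>. \<open>C3 * \<delta> * M\<close> bounds the distance of the end
  slopes in the gaps from the slopes of the interpolant.\<close>

lemma chain_estimate:
  fixes kr :: "int \<Rightarrow> complex"
  assumes \<sigma>: "0 < \<sigma>" "\<And>i. \<sigma> \<le> xL (i + 1) - xR i"
    and \<delta>: "0 < \<delta>" "\<delta> \<le> 1"
    and u: "continuous_on UNIV u" "\<And>x. cmod (u x) \<le> M"
    and gaps: "\<And>i. helmholtz_on k u {xR i<..<xL (i + 1)}"
    and resonators: "\<And>i. helmholtz_on (kr i) u {xL i<..<xR i}"
    and jumps: "\<And>i. deriv_right u (xL i) = of_real \<delta> * deriv_left u (xL i)"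
      "\<And>i. of_real \<delta> * deriv_right u (xR i) = deriv_left u (xR i)"
    and k: "cmod k \<le> \<kappa> * \<delta>" "\<And>i. cmod (kr i) \<le> \<kappa> * \<delta>"
  defines "b \<equiv> \<lambda>i. u (xL i)"
    and "C1 \<equiv> 2 / \<sigma> + \<kappa> * L"
  defines "C2 \<equiv> (C1 + \<kappa> * L) * L"
  defines "C3 \<equiv> \<kappa> * L + C2 / \<sigma>"
  shows "\<And>x. cmod (u x - interp b x) \<le> (L * C3 + C2) * \<delta> * M"
    and "\<And>i. cmod (of_real \<delta> * (slope b i - slope b (i - 1)) + kr i * of_real (xR i - xL i) * b i)
          \<le> (\<kappa> * L * C2 + 2 * C3) * \<delta>\<^sup>2 * M"
proof -
  have M: "0 \<le> M" using u(2)[of 0] norm_ge_zero order_trans by blast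
  have "0 \<le> \<kappa> * \<delta>" using k(1) norm_ge_zero order_trans by blast
  then have \<kappa>: "0 \<le> \<kappa>" using \<delta> by (simp add: zero_le_mult_iff)
  have C: "0 \<le> C1" "0 \<le> C2" "0 \<le> C3"
    using \<sigma> \<kappa> L_pos by (auto simp: C1_def C2_def C3_def)
  have len: "xR i - xL i \<le> L" "xL (i + 1) - xR i \<le> L" for i
    using xL_cell_le[of i] xL_less_xR[of i] xR_less_xL[of i] by auto
  have cont: "continuous_on S u" for S by (rule continuous_on_subset[OF u(1)]) simp
  define \<tau> where "\<tau> i = (u (xL (i + 1)) - u (xR i)) / of_real (xL (i + 1) - xR i)" for i
  note gap_est = helmholtz_gap_estimate[OF xR_less_xL gaps cont u(2), folded \<tau>_def]
  have kM: "cmod k * M * (xL (i + 1) - xR i) \<le> \<kappa> * L * \<delta> * M" for i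
  proof -
    have "cmod k * M * (xL (i + 1) - xR i) \<le> (\<kappa> * \<delta>) * M * L"
      using M k len xR_less_xL[of i] \<open>0 \<le> \<kappa> * \<delta>\<close> by (intro mult_mono) (auto intro: mult_nonneg_nonneg less_imp_le)
    then show ?thesis by (simp add: mult_ac)
  qed
  have gapR: "cmod (deriv_right u (xR i) - \<tau> i) \<le> \<kappa> * L * \<delta> * M" for i
    using gap_est(1)[of i] kM[of i] by linarith
  have gapL: "cmod (deriv_left u (xL (i + 1)) - \<tau> i) \<le> \<kappa> * L * \<delta> * M" for i
    using gap_est(2)[of i] kM[of i] by linarith
  have gapx: "cmod (u x - u (xR i) - of_real (x - xR i) * \<tau> i) \<le> \<kappa> * L * \<delta> * M * L"
    if "xR i \<le> x" "x \<le> xL (i + 1)" for i x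
  proof -
    have "cmod k * M * (xL (i + 1) - xR i)\<^sup>2 \<le> \<kappa> * L * \<delta> * M * L"
      unfolding power2_eq_square mult.assoc[symmetric]
      by (rule mult_mono[OF kM len(2)]) (use xR_less_xL[of i] \<kappa> L_pos \<delta> M in auto)
    then show ?thesis using gap_est(3)[OF that] by linarith
  qed
  have \<tau>_bound: "cmod (\<tau> i) \<le> 2 / \<sigma> * M" for i
  proof -
    have "cmod (u (xL (i + 1)) - u (xR i)) \<le> 2 * M"
      using norm_triangle_ineq4[of "u (xL (i + 1))" "u (xR i)"] u(2)[of "xL (i + 1)"] u(2)[of "xR i"] by linarith
    moreover have "cmod (of_real (xL (i + 1) - xR i)) = xL (i + 1) - xR i"
      using xR_less_xL[of i] unfolding norm_of_real by simp
    ultimately have "cmod (\<tau> i) \<le> 2 * M / \<sigma>"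
      unfolding \<tau>_def norm_divide using \<sigma> M by (auto intro!: frac_le)
    then show ?thesis by simp
  qed
  have left: "cmod (deriv_left u (xL i)) \<le> C1 * M" for i
  proof -
    \<comment> \<open>\<open>\<delta> \<le> 1\<close> absorbs the contribution of the equation into
      \<open>C1\<close>.\<close>
    have "\<kappa> * L * M * \<delta> \<le> \<kappa> * L * M * 1"
      using \<delta> \<kappa> L_pos M by (intro mult_left_mono) auto
    then show ?thesis
      using gapL[of "i - 1"] \<tau>_bound[of "i - 1"] norm_triangle_sub[of "deriv_left u (xL i)" "\<tau> (i - 1)"]
      by (simp add: C1_def algebra_simps)
  qed
  have right: "cmod (deriv_right u (xL i)) \<le> \<delta> * (C1 * M)" for i
    unfolding jumps(1) norm_mult norm_of_real using left[of i] \<delta> by (simp add: mult_left_mono)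
  define E where "E i = (cmod (deriv_right u (xL i)) + cmod (kr i) * M * (xR i - xL i)) * (xR i - xL i)" for i
  note res_est = helmholtz_resonator_estimate[OF xL_less_xR resonators cont u(2), folded E_def]
  have E: "E i \<le> C2 * \<delta> * M" for i
  proof -
    have "cmod (kr i) * M * (xR i - xL i) \<le> (\<kappa> * \<delta>) * M * L"
      using M k len xL_less_xR[of i] \<open>0 \<le> \<kappa> * \<delta>\<close> by (intro mult_mono) (auto intro: mult_nonneg_nonneg less_imp_le)
    then have "E i \<le> (\<delta> * (C1 * M) + (\<kappa> * \<delta>) * M * L) * L"
      unfolding E_def
      by (rule mult_mono[OF add_mono[OF right] len(1)])
         (use xL_less_xR[of i] C \<delta> M \<kappa> L_pos in auto)
    then show ?thesis by (simp add: C2_def algebra_simps)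
  qed
  have res: "cmod (u x - b i) \<le> C2 * \<delta> * M" if "xL i \<le> x" "x \<le> xR i" for i x
    using res_est(1)[OF that] E[of i] unfolding b_def by linarith
  \<comment> \<open>\<open>\<tau> i\<close> uses the true value \<open>u (xR i)\<close>,
    \<open>slope b i\<close> the value \<open>b i\<close> at the other end of the resonator; the end
    value \<open>u (xL (i + 1))\<close> is common to both.\<close>
  have slope_diff: "cmod (\<tau> i - slope b i) \<le> C2 / \<sigma> * \<delta> * M" for i
  proof -
    have "cmod (\<tau> i - slope b i) = cmod (u (xR i) - b i) / (xL (i + 1) - xR i)"
      using xR_less_xL[of i]
      by (simp add: \<tau>_def slope_def b_def norm_divide norm_minus_commute flip: diff_divide_distrib of_real_diff)
    also have "\<dots> \<le> C2 * \<delta> * M / \<sigma>"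
      using res[of i "xR i"] xL_less_xR[of i] \<sigma> C \<delta> M by (intro frac_le) auto
    finally show ?thesis by simp
  qed
  have right_slope: "cmod (deriv_right u (xR i) - slope b i) \<le> C3 * \<delta> * M" for i
    using norm_triangle_ineq[of "deriv_right u (xR i) - \<tau> i" "\<tau> i - slope b i"] gapR[of i] slope_diff[of i]
    by (simp add: C3_def algebra_simps)
  have left_slope: "cmod (deriv_left u (xL (i + 1)) - slope b i) \<le> C3 * \<delta> * M" for i
    using norm_triangle_ineq[of "deriv_left u (xL (i + 1)) - \<tau> i" "\<tau> i - slope b i"] gapL[of i] slope_diff[of i]
    by (simp add: C3_def algebra_simps)
  show "cmod (u x - interp b x) \<le> (L * C3 + C2) * \<delta> * M" for x
  proof (cases rule: resonator_or_gap[of x])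
    case (1 i)
    have "0 \<le> L * C3 * \<delta> * M" using C L_pos \<delta> M by simp
    then show ?thesis using res[OF 1] interp_resonator[OF 1, of b] by (simp add: algebra_simps)
  next
    case (2 i)
    then have x: "xR i \<le> x" "x \<le> xL (i + 1)" by auto
    have "cmod (of_real (x - xR i) * (\<tau> i - slope b i)) \<le> L * (C2 / \<sigma> * \<delta> * M)"
      unfolding norm_mult norm_of_real using slope_diff[of i] x len(2)[of i] L_pos
      by (intro mult_mono) auto
    moreover have "cmod (u (xR i) - b i) \<le> C2 * \<delta> * M"
      using xL_less_xR[of i] by (intro res) auto
    \<comment> \<open>Deviation from the chord, variation over the preceding resonator, and change
      of slope.\<close>
    moreover have "u x - interp b x = (u x - u (xR i) - of_real (x - xR i) * \<tau> i)
        + (u (xR i) - b i) + of_real (x - xR i) * (\<tau> i - slope b i)"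
      unfolding interp_gap[OF x] by (simp add: algebra_simps)
    ultimately have "cmod (u x - interp b x)
        \<le> \<kappa> * L * \<delta> * M * L + C2 * \<delta> * M + L * (C2 / \<sigma> * \<delta> * M)"
      using gapx[OF x] by (metis (no_types, lifting) add_mono norm_triangle_mono)
    then show ?thesis by (simp add: C3_def algebra_simps)
  qed
  show "cmod (of_real \<delta> * (slope b i - slope b (i - 1)) + kr i * of_real (xR i - xL i) * b i)
      \<le> (\<kappa> * L * C2 + 2 * C3) * \<delta>\<^sup>2 * M" for i
  proof -
    define X where "X = deriv_left u (xR i) - deriv_right u (xL i) + kr i * of_real (xR i - xL i) * u (xL i)"
    have "cmod X \<le> cmod (kr i) * E i * (xR i - xL i)"
      unfolding X_def by (rule res_est(2))
    also have "\<dots> \<le> (\<kappa> * \<delta>) * (C2 * \<delta> * M) * L"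
      using k(2)[of i] E[of i] len(1)[of i] xL_less_xR[of i] \<open>0 \<le> \<kappa> * \<delta>\<close> C \<delta> M
      by (intro mult_mono) (auto simp: E_def intro!: mult_nonneg_nonneg)
    finally have X: "cmod X \<le> \<kappa> * L * C2 * \<delta>\<^sup>2 * M" by (simp add: power2_eq_square mult_ac)
    \<comment> \<open>The jump conditions turn both derivatives inside the resonator into
      \<open>\<delta>\<close> times outer ones, so slope errors of order \<open>\<delta>\<close>
      enter with a second factor \<open>\<delta>\<close>.\<close>
    have e: "cmod (of_real \<delta> * (deriv_right u (xR i) - slope b i)) \<le> \<delta> * (C3 * \<delta> * M)"
        "cmod (of_real \<delta> * (deriv_left u (xL i) - slope b (i - 1))) \<le> \<delta> * (C3 * \<delta> * M)"
      unfolding norm_mult norm_of_real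
      using right_slope[of i] left_slope[of "i - 1"] \<delta> by (simp_all add: mult_left_mono)
    have "of_real \<delta> * (slope b i - slope b (i - 1)) + kr i * of_real (xR i - xL i) * b i
        = X - (of_real \<delta> * (deriv_right u (xR i) - slope b i) - of_real \<delta> * (deriv_left u (xL i) - slope b (i - 1)))"
      unfolding X_def jumps(1) jumps(2)[symmetric] b_def by (simp add: algebra_simps)
    also have "cmod \<dots> \<le> \<kappa> * L * C2 * \<delta>\<^sup>2 * M + (\<delta> * (C3 * \<delta> * M) + \<delta> * (C3 * \<delta> * M))"
      by (intro order_trans[OF norm_triangle_ineq4] add_mono X e)
    finally show ?thesis by (simp add: power2_eq_square algebra_simps)
  qed
qed

section \<open>Periodicity, maximum and uniform estimates of resonant solutions\<close>

lemma resonator_translate: "resonator xL xR i = (\<lambda>x. x + of_int (turn i) * L) ` resonator xL xR (cell i)"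
proof -
  define c where "c = of_int (turn i) * L"
  have eq: "xL i = xL (cell i) + c" "xR i = xR (cell i) + c"
    using xL_shift[of "cell i" "turn i"] xR_shift[of "cell i" "turn i"]
    by (simp_all add: c_def cell_turn)
  have "y \<in> (\<lambda>x. x + c) ` {xL (cell i)<..<xR (cell i)}" if "y \<in> {xL i<..<xR i}" for y
    by (rule image_eqI[where x = "y - c"]) (use that in \<open>auto simp: eq\<close>)
  then show ?thesis unfolding c_def[symmetric] resonator_def by (auto simp: eq)
qed

lemma resonant_solution_shift:
  assumes "resonant_solution N L xL xR v vr \<alpha> \<delta> \<omega> u"
  shows "u (x + of_int m * L) = cis (\<alpha> * of_int m * L) * u x"
proof -
  have step: "u (y + L) = cis (\<alpha> * L) * u y" for y
    using assms by (simp add: resonant_solution_def)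
  show ?thesis
  proof (induction m rule: int_induct[of _ 0])
    case (step1 m)
    have "u (x + of_int (m + 1) * L) = cis (\<alpha> * L) * u (x + of_int m * L)"
      using step[of "x + of_int m * L"] by (simp add: algebra_simps)
    then show ?case unfolding step1 by (simp add: cis_mult algebra_simps)
  next
    case (step2 m)
    have "cis (\<alpha> * of_int m * L) * u x = cis (\<alpha> * L) * u (x + of_int (m - 1) * L)"
      using step[of "x + of_int (m - 1) * L"] step2 by (simp add: algebra_simps)
    moreover have "cis (\<alpha> * of_int m * L) = cis (\<alpha> * L) * cis (\<alpha> * of_int (m - 1) * L)"
      by (simp add: cis_mult algebra_simps)
    ultimately have "cis (\<alpha> * L) * u (x + of_int (m - 1) * L) =
        cis (\<alpha> * L) * (cis (\<alpha> * of_int (m - 1) * L) * u x)"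
      by (simp only: mult.assoc)
    then show ?case by (rule mult_left_cancel[OF cis_neq_zero, THEN iffD1])
  qed simp
qed

lemma resonant_solution_quasiperiodic:
  assumes "resonant_solution N L xL xR v vr \<alpha> \<delta> \<omega> u"
  shows "quasiperiodic \<alpha> (\<lambda>i. u (xL i))"
  using resonant_solution_shift[OF assms] by (simp add: quasiperiodic_def xL_shift)

text \<open>The modulus is continuous and periodic, so its supremum is attained within one period;
  it is the scale against which all errors are measured.\<close>

lemma resonant_solution_max:
  assumes "resonant_solution N L xL xR v vr \<alpha> \<delta> \<omega> u"
  obtains x0 where "u x0 \<noteq> 0" "\<And>x. cmod (u x) \<le> cmod (u x0)"
proof -
  have cont: "continuous_on {0..L} u"
    using assms continuous_on_subset by (auto simp: resonant_solution_def)
  obtain x0 where x0: "\<And>x. x \<in> {0..L} \<Longrightarrow> cmod (u x) \<le> cmod (u x0)"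
    using continuous_attains_sup[of "{0..L}" "\<lambda>x. cmod (u x)"] continuous_on_norm[OF cont] L_pos
    by (metis atLeastAtMost_iff compact_Icc empty_iff less_imp_le order_refl)
  have max: "cmod (u x) \<le> cmod (u x0)" for x
  proof -
    define m where "m = \<lfloor>x / L\<rfloor>"
    have "x - of_int m * L \<in> {0..L}"
      using floor_divide_lower[OF L_pos, of x] floor_divide_upper[OF L_pos, of x]
      by (auto simp: m_def algebra_simps)
    then have "cmod (u (x - of_int m * L)) \<le> cmod (u x0)" by (rule x0)
    moreover have "cmod (u x) = cmod (u (x - of_int m * L))"
      using resonant_solution_shift[OF assms, of "x - of_int m * L" m] by (simp add: norm_mult)
    ultimately show ?thesis by simp
  qed
  moreover have "u x0 \<noteq> 0"
  proof
    assume "u x0 = 0"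
    then have "u = (\<lambda>x. 0)" using max by auto
    then show False using assms by (simp add: resonant_solution_def)
  qed
  ultimately show thesis using that by blast
qed

lemma resonant_solution_estimate:
  assumes "0 \<le> \<kappa>"
  obtains C where "0 \<le> C"
    and "\<And>\<delta> \<omega> u M x. 0 < \<delta> \<Longrightarrow> \<delta> \<le> 1 \<Longrightarrow> resonant_solution N L xL xR v vr \<alpha> \<delta> \<omega> u \<Longrightarrow>
      cmod (\<omega>\<^sup>2) \<le> \<kappa> * \<delta> \<Longrightarrow> (\<forall>x. cmod (u x) \<le> M) \<Longrightarrow>
      cmod (u x - interp (\<lambda>i. u (xL i)) x) \<le> C * \<delta> * M"
    and "\<And>\<delta> \<omega> u M i. 0 < \<delta> \<Longrightarrow> \<delta> \<le> 1 \<Longrightarrow> resonant_solution N L xL xR v vr \<alpha> \<delta> \<omega> u \<Longrightarrow>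
      cmod (\<omega>\<^sup>2) \<le> \<kappa> * \<delta> \<Longrightarrow> (\<forall>x. cmod (u x) \<le> M) \<Longrightarrow>
      cmod (of_real \<delta> * (slope (\<lambda>i. u (xL i)) i - slope (\<lambda>i. u (xL i)) (i - 1)) +
        \<omega>\<^sup>2 / (vr (cell i))\<^sup>2 * of_real (xR i - xL i) * u (xL i)) \<le> C * \<delta>\<^sup>2 * M"
proof -
  obtain \<sigma> where \<sigma>: "0 < \<sigma>" "\<And>i. \<sigma> \<le> xL (i + 1) - xR i" by (rule gap_lower_bound) (rule that; assumption)
  \<comment> \<open>\<open>Q\<close> dominates the reciprocal squared wave speeds of the background
    and of all resonators, so that \<open>\<kappa>' * \<delta>\<close> bounds every coefficient of
    the equation.\<close>
  define Q where "Q = 1 / v\<^sup>2 + (\<Sum>i\<in>{1..int N}. 1 / cmod ((vr i)\<^sup>2))"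
  define \<kappa>' where "\<kappa>' = \<kappa> * Q"
  have Q: "1 / v\<^sup>2 \<le> Q" "1 / cmod ((vr (cell i))\<^sup>2) \<le> Q" for i
  proof -
    have "1 / cmod ((vr (cell i))\<^sup>2) \<le> (\<Sum>i\<in>{1..int N}. 1 / cmod ((vr i)\<^sup>2))"
      by (rule member_le_sum[where f = "\<lambda>i. 1 / cmod ((vr i)\<^sup>2)"]) (use cell_range in auto)
    then show "1 / cmod ((vr (cell i))\<^sup>2) \<le> Q" unfolding Q_def by (rule add_increasing[rotated]) simp
    show "1 / v\<^sup>2 \<le> Q" unfolding Q_def by (simp add: sum_nonneg)
  qed
  then have Q0: "0 \<le> Q" using zero_le_divide_1_iff zero_le_power2 order_trans by blast
  define C1 where "C1 = 2 / \<sigma> + \<kappa>' * L"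
  define C2 where "C2 = (C1 + \<kappa>' * L) * L"
  define C3 where "C3 = \<kappa>' * L + C2 / \<sigma>"
  define C where "C = (L * C3 + C2) + (\<kappa>' * L * C2 + 2 * C3)"
  have \<kappa>': "0 \<le> \<kappa>'" using assms Q0 by (simp add: \<kappa>'_def)
  have "0 \<le> C1" using \<sigma>(1) \<kappa>' L_pos by (simp add: C1_def)
  then have "0 \<le> C2" using \<kappa>' L_pos by (simp add: C2_def)
  then have "0 \<le> C3" using \<sigma>(1) \<kappa>' L_pos by (simp add: C3_def)
  then have C: "L * C3 + C2 \<le> C" "\<kappa>' * L * C2 + 2 * C3 \<le> C" "0 \<le> C"
    using \<open>0 \<le> C2\<close> \<kappa>' L_pos by (simp_all add: C_def)
  have main: "(\<forall>x. cmod (u x - interp (\<lambda>i. u (xL i)) x) \<le> C * \<delta> * M) \<and>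
      (\<forall>i. cmod (of_real \<delta> * (slope (\<lambda>i. u (xL i)) i - slope (\<lambda>i. u (xL i)) (i - 1)) +
        \<omega>\<^sup>2 / (vr (cell i))\<^sup>2 * of_real (xR i - xL i) * u (xL i)) \<le> C * \<delta>\<^sup>2 * M)"
    if \<delta>: "0 < \<delta>" "\<delta> \<le> 1" and sol: "resonant_solution N L xL xR v vr \<alpha> \<delta> \<omega> u"
      and \<omega>: "cmod (\<omega>\<^sup>2) \<le> \<kappa> * \<delta>" and M: "\<forall>x. cmod (u x) \<le> M" for \<delta> \<omega> u M
  proof -
    have gaps: "helmholtz_on (\<omega>\<^sup>2 / (of_real v)\<^sup>2) u {xR i<..<xL (i + 1)}" for i
      using sol helmholtz_on_subset[OF _ gap_subset] by (simp add: resonant_solution_def)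
    have resonators: "helmholtz_on (\<omega>\<^sup>2 / (vr (cell i))\<^sup>2) u {xL i<..<xR i}" for i
    proof (rule helmholtz_on_subset)
      show "helmholtz_on (\<omega>\<^sup>2 / (vr (cell i))\<^sup>2) u
          (\<Union>m::int. (\<lambda>x. x + of_int m * L) ` resonator xL xR (cell i))"
        using sol cell_range by (simp add: resonant_solution_def)
      show "{xL i<..<xR i} \<subseteq> (\<Union>m::int. (\<lambda>x. x + of_int m * L) ` resonator xL xR (cell i))"
        using resonator_translate[of i] unfolding resonator_def[of xL xR i] by auto
    qed
    have k: "cmod (\<omega>\<^sup>2 / c) \<le> \<kappa>' * \<delta>" if "1 / cmod c \<le> Q" for c
    proof -
      have "cmod (\<omega>\<^sup>2) * (1 / cmod c) \<le> (\<kappa> * \<delta>) * Q"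
        using \<omega> that assms \<delta> by (intro mult_mono) auto
      then show ?thesis by (simp add: norm_divide \<kappa>'_def mult_ac)
    qed
    have k1: "cmod (\<omega>\<^sup>2 / (of_real v)\<^sup>2) \<le> \<kappa>' * \<delta>"
      using Q(1) by (intro k) (simp add: norm_power)
    have cont: "continuous_on UNIV u" using sol by (simp add: resonant_solution_def)
    have jumps: "deriv_right u (xL i) = of_real \<delta> * deriv_left u (xL i)"
      "of_real \<delta> * deriv_right u (xR i) = deriv_left u (xR i)" for i
      using sol by (simp_all add: resonant_solution_def)
    have M0: "0 \<le> M" using M norm_ge_zero order_trans by blast
    note est = chain_estimate[OF \<sigma> \<delta> cont M[rule_format] gaps resonators jumps k1 k[OF Q(2)],
        folded C1_def, folded C2_def, folded C3_def]
    have "(L * C3 + C2) * \<delta> * M \<le> C * \<delta> * M" "(\<kappa>' * L * C2 + 2 * C3) * \<delta>\<^sup>2 * M \<le> C * \<delta>\<^sup>2 * M"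
      using C M0 \<delta> by (intro mult_right_mono; simp)+
    then show ?thesis using est order_trans by blast
  qed
  show thesis
  proof (rule that[of C])
    show "0 \<le> C" by (rule C)
  qed (use main in blast)+
qed

text \<open>Interpolation and eigenvector perturbation show that \<open>u\<close> differs from
  \<open>c * interp d\<close> by at most \<open>K2 * \<delta> * M\<close>. At a point of maximal
  modulus this gives \<open>M \<le> 2 * (cmod c * B)\<close> for small \<open>\<delta>\<close>;
  hence \<open>c\<close> is nonzero, and division by it turns the relative error into an absolute
  one.\<close>

lemma resonant_mode_estimate:
  fixes d :: "int \<Rightarrow> complex"
  assumes vr: "\<And>i. i \<in> {1..int N} \<Longrightarrow> vr i \<noteq> 0"
    and ord: "Polynomial.order lam (char_poly (gen_cap_matrix N L xL xR vr \<alpha>)) = 1"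
    and d: "quasiperiodic \<alpha> d" and nz: "i0 < N" "d (int i0 + 1) \<noteq> 0"
    and eig: "\<And>i. i < N \<Longrightarrow>
      (\<Sum>j<N. gen_cap_matrix N L xL xR vr \<alpha> $$ (i, j) * d (int j + 1)) = lam * d (int i + 1)"
  obtains K \<epsilon> where "0 < \<epsilon>"
    and "\<And>\<delta> \<omega> u. 0 < \<delta> \<Longrightarrow> \<delta> < \<epsilon> \<Longrightarrow> cmod (\<omega>\<^sup>2 / of_real \<delta> - lam) < \<epsilon> \<Longrightarrow>
      resonant_solution N L xL xR v vr \<alpha> \<delta> \<omega> u \<Longrightarrow>
      \<exists>c. c \<noteq> 0 \<and> (\<forall>x. cmod (c * u x - interp d x) \<le> K * \<delta>)"
proof -
  define A where "A = gen_cap_matrix N L xL xR vr \<alpha>"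
  obtain K1 where K1: "0 \<le> K1" "\<forall>\<^sub>F \<mu> in nhds lam. \<forall>b \<eta>.
      (\<forall>i<N. cmod ((\<Sum>j<N. A $$ (i, j) * b j) - \<mu> * b i) \<le> \<eta>) \<longrightarrow>
      (\<exists>c. \<forall>i<N. cmod (b i - c * d (int i + 1)) \<le> K1 * \<eta>)"
    by (rule simple_eigenvalue_perturbation[where a = "\<lambda>i. d (int i + 1)",
          OF gen_cap_matrix_carrier ord eig nz, folded A_def]) (assumption, (rule that; assumption))
  then obtain \<epsilon>1 where "0 < \<epsilon>1" and pert: "\<And>\<mu> b \<eta>. dist \<mu> lam < \<epsilon>1 \<Longrightarrow>
      \<forall>i<N. cmod ((\<Sum>j<N. A $$ (i, j) * b j) - \<mu> * b i) \<le> \<eta> \<Longrightarrow>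
      \<exists>c. \<forall>i<N. cmod (b i - c * d (int i + 1)) \<le> K1 * \<eta>"
    unfolding eventually_nhds_metric by blast
  \<comment> \<open>This plays the role of \<open>\<kappa>\<close> as soon as
    \<open>\<omega>\<^sup>2 / \<delta>\<close> is within distance one of \<open>lam\<close>.\<close>
  have "0 \<le> cmod lam + 1" by simp
  then obtain C where C: "0 \<le> C" and est1: "\<And>\<delta> \<omega> u M x. 0 < \<delta> \<Longrightarrow> \<delta> \<le> 1 \<Longrightarrow>
      resonant_solution N L xL xR v vr \<alpha> \<delta> \<omega> u \<Longrightarrow>
      cmod (\<omega>\<^sup>2) \<le> (cmod lam + 1) * \<delta> \<Longrightarrow> (\<forall>x. cmod (u x) \<le> M) \<Longrightarrow>
      cmod (u x - interp (\<lambda>i. u (xL i)) x) \<le> C * \<delta> * M"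
    and est2: "\<And>\<delta> \<omega> u M i. 0 < \<delta> \<Longrightarrow> \<delta> \<le> 1 \<Longrightarrow> resonant_solution N L xL xR v vr \<alpha> \<delta> \<omega> u \<Longrightarrow>
      cmod (\<omega>\<^sup>2) \<le> (cmod lam + 1) * \<delta> \<Longrightarrow> (\<forall>x. cmod (u x) \<le> M) \<Longrightarrow>
      cmod (of_real \<delta> * (slope (\<lambda>i. u (xL i)) i - slope (\<lambda>i. u (xL i)) (i - 1)) +
        \<omega>\<^sup>2 / (vr (cell i))\<^sup>2 * of_real (xR i - xL i) * u (xL i)) \<le> C * \<delta>\<^sup>2 * M"
    by (rule resonant_solution_estimate[where v = v and vr = vr and \<alpha> = \<alpha>]) (rule that; assumption)
  define F where "F = (\<Sum>i\<in>{1..int N}. cmod ((vr i)\<^sup>2) / (xR i - xL i))"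
  have F_nonneg: "0 \<le> cmod ((vr i)\<^sup>2) / (xR i - xL i)" for i
    using xL_less_xR[of i] by simp
  then have F0: "0 \<le> F" unfolding F_def by (intro sum_nonneg)
  have F: "cmod ((vr i)\<^sup>2) / (xR i - xL i) \<le> F" if "i \<in> {1..int N}" for i
    unfolding F_def using that F_nonneg
    by (intro member_le_sum[where f = "\<lambda>i. cmod ((vr i)\<^sup>2) / (xR i - xL i)"]) auto
  \<comment> \<open>Interpolation error plus the perturbation bound for a residual of size
    \<open>F * C * \<delta> * M\<close>.\<close>
  define K2 where "K2 = C + K1 * (F * C)"
  have K2: "0 \<le> K2" using C F0 K1(1) by (simp add: K2_def)
  define B where "B = (\<Sum>j<N. cmod (d (int j + 1)))"
  have B: "cmod (d i) \<le> B" for i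
  proof -
    define j where "j = nat (cell i - 1)"
    have j: "int j + 1 = cell i" "j < N" using cell_range[of i] by (auto simp: j_def)
    have "cmod (d (int j + 1)) \<le> B"
      unfolding B_def by (rule member_le_sum[where f = "\<lambda>j. cmod (d (int j + 1))"]) (use j in auto)
    then show ?thesis using quasiperiodic_norm[OF d, of i] j by simp
  qed
  have B0: "0 \<le> B" by (simp add: B_def sum_nonneg)
  \<comment> \<open>The entry 1 yields \<open>\<delta> \<le> 1\<close> and
    \<open>cmod \<mu> \<le> cmod lam + 1\<close>, \<open>\<epsilon>1\<close> gives access to the
    perturbation bound, and the last entry yields \<open>K2 * \<delta> \<le> 1 / 2\<close>.\<close>
  define \<epsilon> where "\<epsilon> = min (min 1 \<epsilon>1) (1 / (2 * (K2 + 1)))"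
  have \<epsilon>: "0 < \<epsilon>" using \<open>0 < \<epsilon>1\<close> K2 by (simp add: \<epsilon>_def)
  have main: "\<exists>c. c \<noteq> 0 \<and> (\<forall>x. cmod (c * u x - interp d x) \<le> 2 * B * K2 * \<delta>)"
    if \<delta>: "0 < \<delta>" "\<delta> < \<epsilon>" and close: "cmod (\<omega>\<^sup>2 / of_real \<delta> - lam) < \<epsilon>"
      and sol: "resonant_solution N L xL xR v vr \<alpha> \<delta> \<omega> u" for \<delta> \<omega> u
  proof -
    have \<delta>1: "\<delta> \<le> 1" using \<delta> by (simp add: \<epsilon>_def)
    define \<mu> where "\<mu> = \<omega>\<^sup>2 / of_real \<delta>"
    have \<omega>: "\<omega>\<^sup>2 = of_real \<delta> * \<mu>" using \<delta> by (simp add: \<mu>_def)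
    have \<mu>: "dist \<mu> lam < \<epsilon>1" "cmod \<mu> \<le> cmod lam + 1"
      using close norm_triangle_sub[of \<mu> lam] by (auto simp: \<mu>_def dist_norm \<epsilon>_def)
    have \<omega>_bound: "cmod (\<omega>\<^sup>2) \<le> (cmod lam + 1) * \<delta>"
      unfolding \<omega> norm_mult norm_of_real using \<mu>(2) \<delta> by (simp add: mult.commute mult_right_mono)
    obtain x0 where x0: "u x0 \<noteq> 0" "\<And>x. cmod (u x) \<le> cmod (u x0)"
      by (rule resonant_solution_max[OF sol]) (rule that; assumption)
    define M where "M = cmod (u x0)"
    have M: "0 < M" "\<forall>x. cmod (u x) \<le> M" using x0 by (auto simp: M_def)
    define b where "b i = u (xL i)" for i
    have b: "quasiperiodic \<alpha> b"
      using resonant_solution_quasiperiodic[OF sol] by (simp add: b_def[abs_def])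
    note e1 = est1[OF \<delta>(1) \<delta>1 sol \<omega>_bound M(2), folded b_def]
    note e2 = est2[OF \<delta>(1) \<delta>1 sol \<omega>_bound M(2), folded b_def]
    have res: "cmod ((\<Sum>j<N. A $$ (i, j) * b (int j + 1)) - \<mu> * b (int i + 1)) \<le> F * C * \<delta> * M"
      if i: "i < N" for i
    proof -
      define k where "k = int i + 1"
      have k: "k \<in> {1..int N}" "k - 1 = int i" "cell k = k"
        using i cell_turn_eq[of k 0] by (auto simp: k_def)
      define l where "l = xR k - xL k"
      have l: "0 < l" using xL_less_xR[of k] by (simp add: l_def)
      define Z where "Z = of_real \<delta> * (slope b k - slope b (k - 1)) + \<omega>\<^sup>2 / (vr k)\<^sup>2 * of_real l * b k"
      have Z: "cmod Z \<le> C * \<delta>\<^sup>2 * M" using e2[of k] by (simp add: Z_def k(3) l_def)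
      have "(\<Sum>j<N. A $$ (i, j) * b (int j + 1)) - \<mu> * b k
          = (vr k)\<^sup>2 / of_real l * (slope b (k - 1) - slope b k) - \<mu> * b k"
        unfolding A_def gen_cap_matrix_apply[OF b i] by (simp add: k_def l_def resonator_length_def)
      \<comment> \<open>Dividing the flux balance \<open>Z\<close> by \<open>\<delta>\<close> costs
        one of its two factors \<open>\<delta>\<close> and leaves a residual of first order.\<close>
      also have "\<dots> = - ((vr k)\<^sup>2 / of_real l / of_real \<delta>) * Z"
        using vr[OF k(1)] l \<delta> unfolding Z_def \<omega> by (simp add: field_simps)
      finally have "cmod ((\<Sum>j<N. A $$ (i, j) * b (int j + 1)) - \<mu> * b k)
          = cmod ((vr k)\<^sup>2) / l / \<delta> * cmod Z"
        using l \<delta> by (simp add: norm_mult norm_divide)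
      also have "\<dots> \<le> F / \<delta> * (C * \<delta>\<^sup>2 * M)"
        using F[OF k(1)] F0 \<delta> by (intro mult_mono Z divide_right_mono) (auto simp: l_def)
      also have "\<dots> = F * C * \<delta> * M" using \<delta> by (simp add: power2_eq_square)
      finally show ?thesis by (simp add: k_def)
    qed
    obtain c where c: "\<And>i. i < N \<Longrightarrow> cmod (b (int i + 1) - c * d (int i + 1)) \<le> K1 * (F * C * \<delta> * M)"
      using pert[OF \<mu>(1), of "\<lambda>j. b (int j + 1)" "F * C * \<delta> * M"] res by auto
    \<comment> \<open>The modulus of a quasiperiodic sequence depends only on the cell, so the bound
      passes from \<open>N\<close> indices to all.\<close>
    have bc: "cmod (b i - c * d i) \<le> K1 * (F * C * \<delta> * M)" for i
    proof -
      have "quasiperiodic \<alpha> (\<lambda>i. b i - c * d i)"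
        using b d by (simp add: quasiperiodic_def right_diff_distrib)
      then have "cmod (b i - c * d i) = cmod (b (cell i) - c * d (cell i))"
        by (rule quasiperiodic_norm)
      moreover have "int (nat (cell i - 1)) + 1 = cell i" "nat (cell i - 1) < N"
        using cell_range[of i] by auto
      ultimately show ?thesis using c[of "nat (cell i - 1)"] by simp
    qed
    have u_approx: "cmod (u x - c * interp d x) \<le> K2 * \<delta> * M" for x
    proof -
      have "cmod (interp b x - c * interp d x) \<le> K1 * (F * C * \<delta> * M)"
        using norm_interp_le[of "\<lambda>i. b i - c * d i", OF bc, of x] by (simp add: interp_diff_scaled)
      then have "cmod ((u x - interp b x) + (interp b x - c * interp d x))
          \<le> C * \<delta> * M + K1 * (F * C * \<delta> * M)"
        using e1[of x] by (intro norm_triangle_le add_mono) (simp_all add: b_def[abs_def])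
      then show ?thesis by (simp add: K2_def algebra_simps)
    qed
    have "K2 * \<delta> \<le> 1 / 2"
    proof -
      have "K2 * \<delta> \<le> (K2 + 1) * (1 / (2 * (K2 + 1)))"
        using K2 \<delta> by (intro mult_mono) (auto simp: \<epsilon>_def)
      also have "\<dots> = 1 / 2" using K2 by (simp add: divide_simps)
      finally show ?thesis .
    qed
    then have "K2 * \<delta> * M \<le> 1 / 2 * M" using M by (intro mult_right_mono) auto
    moreover have "M \<le> cmod c * B + K2 * \<delta> * M"
    proof -
      have "cmod (c * interp d x0) \<le> cmod c * B"
        unfolding norm_mult by (intro mult_left_mono norm_interp_le B) simp
      then show ?thesis
        using u_approx[of x0] norm_triangle_sub[of "u x0" "c * interp d x0"] by (simp add: M_def)
    qed
    ultimately have M_le: "M \<le> 2 * (cmod c * B)" by simp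
    then have c0: "c \<noteq> 0" using M by auto
    have "cmod (1 / c * u x - interp d x) \<le> 2 * B * K2 * \<delta>" for x
    proof -
      have "1 / c * u x - interp d x = (u x - c * interp d x) / c"
        using c0 by (simp add: diff_divide_distrib)
      then have "cmod (1 / c * u x - interp d x) \<le> K2 * \<delta> * M / cmod c"
        using u_approx[of x] by (simp add: norm_divide divide_right_mono)
      also have "\<dots> \<le> K2 * \<delta> * (2 * (cmod c * B)) / cmod c"
        using M_le K2 \<delta> by (intro divide_right_mono mult_left_mono) auto
      also have "\<dots> = 2 * B * K2 * \<delta>" using c0 by simp
      finally show ?thesis .
    qed
    then show ?thesis using c0 by (intro exI[of _ "1 / c"]) simp
  qed
  show thesis by (rule that[of \<epsilon> "2 * B * K2"]) (use \<epsilon> main in blast)+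
qed

end

text \<open>With \<open>w\<close> the leading term, the factors of
  \<open>(\<omega> - w) * (\<omega> + w)\<close> are O(\<delta>) and O(sqrt \<delta>). Division by
  \<open>\<delta>\<close> leaves an error of order sqrt \<delta>: enough for convergence, but too
  coarse for an O(\<delta>) result, which is why the eigenvector perturbation is uniform in
  \<open>\<mu>\<close>.\<close>

lemma square_quotient_tendsto:
  fixes \<omega> :: "real \<Rightarrow> complex"
  assumes "sgm \<in> {1, - 1}"
    and asym: "(\<lambda>\<delta>. \<omega> \<delta> - sgm * csqrt (of_real \<delta> * lam)) \<in> O[at_right 0](\<lambda>\<delta>. of_real \<delta>)"
  shows "((\<lambda>\<delta>. (\<omega> \<delta>)\<^sup>2 / of_real \<delta>) \<longlongrightarrow> lam) (at_right 0)"
proof -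
  obtain c where c: "\<forall>\<^sub>F \<delta> in at_right 0.
      cmod (\<omega> \<delta> - sgm * csqrt (of_real \<delta> * lam)) \<le> c * cmod (of_real \<delta>)" and c0: "c > 0"
    using landau_o.bigE[OF asym] by metis
  have "\<forall>\<^sub>F \<delta> in at_right 0. cmod ((\<omega> \<delta>)\<^sup>2 / of_real \<delta> - lam)
      \<le> c * (c * \<delta> + 2 * sqrt (\<delta> * cmod lam))"
    using c eventually_at_right_less[of 0]
  proof eventually_elim
    case (elim \<delta>)
    define w where "w = sgm * csqrt (of_real \<delta> * lam)"
    \<comment> \<open>Squaring removes both the sign and the branch of the root.\<close>
    have w2: "w\<^sup>2 = of_real \<delta> * lam"
      using assms(1) by (auto simp: w_def power_mult_distrib)
    have "(cmod w)\<^sup>2 = \<delta> * cmod lam"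
      using elim(2) by (simp add: w2 norm_mult flip: norm_power)
    then have wn: "cmod w = sqrt (\<delta> * cmod lam)"
      by (metis norm_ge_zero real_sqrt_unique)
    have e: "cmod (\<omega> \<delta> - w) \<le> c * \<delta>" using elim by (simp add: w_def)
    have "cmod (\<omega> \<delta> + w) \<le> c * \<delta> + 2 * sqrt (\<delta> * cmod lam)"
      using norm_triangle_ineq[of "\<omega> \<delta> - w" "2 * w"] e wn
      by (simp add: norm_mult add.commute[of w])
    with e have "cmod ((\<omega> \<delta> - w) * (\<omega> \<delta> + w)) \<le> c * \<delta> * (c * \<delta> + 2 * sqrt (\<delta> * cmod lam))"
      unfolding norm_mult using c0 elim(2) by (intro mult_mono) auto
    moreover have "(\<omega> \<delta>)\<^sup>2 / of_real \<delta> - lam = (\<omega> \<delta> - w) * (\<omega> \<delta> + w) / of_real \<delta>"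
    proof -
      have "(\<omega> \<delta> - w) * (\<omega> \<delta> + w) = (\<omega> \<delta>)\<^sup>2 - of_real \<delta> * lam"
        unfolding w2[symmetric] by (simp add: power2_eq_square algebra_simps)
      then show ?thesis using elim(2) by (simp add: diff_divide_distrib)
    qed
    ultimately have "cmod ((\<omega> \<delta>)\<^sup>2 / of_real \<delta> - lam)
        \<le> c * \<delta> * (c * \<delta> + 2 * sqrt (\<delta> * cmod lam)) / \<bar>\<delta>\<bar>"
      by (simp only: norm_divide norm_of_real divide_right_mono abs_ge_zero)
    then show ?case using elim(2) by simp
  qed
  moreover have "((\<lambda>\<delta>. c * (c * \<delta> + 2 * sqrt (\<delta> * cmod lam))) \<longlongrightarrow> 0) (at_right 0)"
    by (rule tendsto_eq_intros refl | simp)+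
  ultimately have "((\<lambda>\<delta>. (\<omega> \<delta>)\<^sup>2 / of_real \<delta> - lam) \<longlongrightarrow> 0) (at_right 0)"
    by (rule Lim_null_comparison)
  then show ?thesis by (rule Lim_null[THEN iffD2])
qed

section \<open>Leading-order profile of the normalised modes\<close>

theorem lemma4p10:
  fixes N :: nat and L v \<alpha> :: real and xL xR :: "int \<Rightarrow> real" and vr :: "int \<Rightarrow> complex"
    and \<omega> :: "real \<Rightarrow> complex" and sgm lam :: complex and a :: "complex vec"
    and u :: "real \<Rightarrow> real \<Rightarrow> complex"
  assumes geometry: "chain N L xL xR"
    and speeds: "v > 0" "\<And>i. i \<in> {1..int N} \<Longrightarrow> vr i \<noteq> 0"
    and simple: "simple_eigenvalues (gen_cap_matrix N L xL xR vr \<alpha>)"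
    and resonance: "subwavelength_resonance N L xL xR v vr \<alpha> \<omega>"
    and eigenvalue: "eigenvalue (gen_cap_matrix N L xL xR vr \<alpha>) lam"
    and sign: "sgm \<in> {1, - 1}"
    and asymptotics: "(\<lambda>\<delta>. \<omega> \<delta> - sgm * csqrt (of_real \<delta> * lam))
           \<in> O[at_right 0](\<lambda>\<delta>. of_real \<delta>)"
    and eigenvector: "eigenvector (gen_cap_matrix N L xL xR vr \<alpha>) a lam"
    and mode: "resonant_mode N L xL xR v vr \<alpha> \<omega> u"
  shows "\<exists>c :: real \<Rightarrow> complex. (\<forall>\<delta>. c \<delta> \<noteq> 0) \<and>
           (\<exists>K. \<forall>\<^sub>F \<delta> in at_right 0. \<forall>x.
              cmod (c \<delta> * u \<delta> x -
                    (\<Sum>j<N. vec_index a j * cap_potential N L xL xR \<alpha> (int j + 1) x)) \<le> K * \<delta>)"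
proof -
  interpret periodic_chain N L xL xR by (rule periodic_chain.intro[OF geometry])
  define A where "A = gen_cap_matrix N L xL xR vr \<alpha>"
  have A: "A \<in> carrier_mat N N" unfolding A_def by (rule gen_cap_matrix_carrier)
  have a: "a \<in> carrier_vec N" "a \<noteq> 0\<^sub>v N" "A *\<^sub>v a = lam \<cdot>\<^sub>v a"
    using eigenvector A unfolding eigenvector_def A_def by auto
  \<comment> \<open>Extending the eigenvector quasiperiodically makes \<open>interp d\<close> the
    claimed leading term.\<close>
  define d where "d i = (\<Sum>j<N. vec_index a j * unit_seq \<alpha> (int j + 1) i)" for i
  have d: "quasiperiodic \<alpha> d"
    using quasiperiodic_unit_seq unfolding quasiperiodic_def d_def
    by (simp add: sum_distrib_left mult.left_commute)
  have d_index: "d (int i + 1) = vec_index a i" if "i < N" for i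
  proof -
    have "d (int i + 1) = (\<Sum>j<N. if j = i then vec_index a j else 0)"
      unfolding d_def using cell_turn_eq[of "int i + 1" 0] that
      by (intro sum.cong) (auto simp: unit_seq_def)
    then show ?thesis using that by simp
  qed
  have interp_d: "interp d x = (\<Sum>j<N. vec_index a j * cap_potential N L xL xR \<alpha> (int j + 1) x)" for x
    by (simp add: d_def[abs_def] interp_sum cap_potential_eq)
  obtain i0 where i0: "i0 < N" "d (int i0 + 1) \<noteq> 0"
  proof -
    have "\<exists>i<N. vec_index a i \<noteq> 0"
      using a by (metis carrier_vecD eq_vecI index_zero_vec(1,2))
    then show thesis using that d_index by auto
  qed
  have eig: "(\<Sum>j<N. A $$ (i, j) * d (int j + 1)) = lam * d (int i + 1)" if i: "i < N" for i
  proof -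
    have "vec_index (A *\<^sub>v a) i = (\<Sum>j<N. A $$ (i, j) * d (int j + 1))"
      using A a(1) i by (simp add: scalar_prod_def d_index atLeast0LessThan)
    then show ?thesis using a i by (simp add: d_index)
  qed
  have ord: "Polynomial.order lam (char_poly A) = 1"
    using simple eigenvalue by (simp add: simple_eigenvalues_def A_def)
  obtain K \<epsilon> where \<epsilon>: "0 < \<epsilon>" and est: "\<And>\<delta> \<omega> u. 0 < \<delta> \<Longrightarrow> \<delta> < \<epsilon> \<Longrightarrow>
      cmod (\<omega>\<^sup>2 / of_real \<delta> - lam) < \<epsilon> \<Longrightarrow> resonant_solution N L xL xR v vr \<alpha> \<delta> \<omega> u \<Longrightarrow>
      \<exists>c. c \<noteq> 0 \<and> (\<forall>x. cmod (c * u x - interp d x) \<le> K * \<delta>)"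
    by (rule resonant_mode_estimate[OF speeds(2) ord[unfolded A_def] d i0 eig[unfolded A_def],
          where v = v]) (assumption, assumption, (rule that; assumption))
  define good where "good \<delta> c \<longleftrightarrow> c \<noteq> 0 \<and> (\<forall>x. cmod (c * u \<delta> x - interp d x) \<le> K * \<delta>)" for \<delta> c
  \<comment> \<open>The default value 1, taken where no admissible factor exists, keeps
    \<open>c\<close> nonzero for every \<open>\<delta>\<close> and not only for small ones.\<close>
  define c where "c \<delta> = (if \<exists>z. good \<delta> z then SOME z. good \<delta> z else 1)" for \<delta>
  have c: "good \<delta> (c \<delta>)" if "\<exists>z. good \<delta> z" for \<delta>
    unfolding c_def using that someI_ex[OF that] by simp
  have "\<forall>\<^sub>F \<delta> in at_right 0. dist ((\<omega> \<delta>)\<^sup>2 / of_real \<delta>) lam < \<epsilon>"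
    by (rule tendstoD[OF square_quotient_tendsto[OF sign asymptotics] \<epsilon>])
  moreover have "\<forall>\<^sub>F \<delta> in at_right 0. \<delta> \<in> {0<..<\<epsilon>}"
    by (rule eventually_at_right_real[OF \<epsilon>])
  moreover have "\<forall>\<^sub>F \<delta> in at_right 0. resonant_solution N L xL xR v vr \<alpha> \<delta> (\<omega> \<delta>) (u \<delta>)"
    using mode by (simp add: resonant_mode_def)
  ultimately have "\<forall>\<^sub>F \<delta> in at_right 0. good \<delta> (c \<delta>)"
  proof eventually_elim
    case (elim \<delta>)
    show ?case
      by (rule c) (use est[of \<delta> "\<omega> \<delta>" "u \<delta>"] elim in \<open>auto simp: good_def dist_norm\<close>)
  qed
  then have "\<forall>\<^sub>F \<delta> in at_right 0. \<forall>x.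
      cmod (c \<delta> * u \<delta> x - (\<Sum>j<N. vec_index a j * cap_potential N L xL xR \<alpha> (int j + 1) x)) \<le> K * \<delta>"
    by eventually_elim (simp add: good_def interp_d)
  moreover have "c \<delta> \<noteq> 0" for \<delta>
    using c[of \<delta>] by (cases "\<exists>z. good \<delta> z") (auto simp: good_def c_def)
  ultimately show ?thesis by blast
qed

end
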